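(* For every integer $k\ge 1$, $\left(\tfrac{1}{2}(k-1)+o(1)\right)n \le \mathrm{bal}_3(n,P_{3k}) \le (k+o(1))n$ as $n\to\infty$.
   Context: $P_m$ denotes the path with $m$ edges. A $3$-edge-colored graph $G$ is balanced if each of the $3$ colors appears on either $\lfloor e(G)/3\rfloor$ or $\lceil e(G)/3\rceil$ edges (so a balanced $P_{3k}$ has exactly $k$ edges of each color). $\mathrm{bal}_3(n,G)$ is the minimum integer $m$ (if it exists) such that every $3$-edge-coloring of $K_n$ with more than $m$ edges in each of the $3$ colors contains a balanced copy of $G$; if no such $m$ exists it is $\infty$. *)

theory Defs
  imports Complex_Main "HOL-Library.Extended_Real" "HOL-Library.Landau_Symbols" "HOL-Library.FuncSet"
begin

text \<open>A finite simple graph is a pair of a vertex set and a set of two-element subsets of it.\<close>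

type_synonym 'a ugraph = "'a set \<times> 'a set set"

definition verts :: "'a ugraph \<Rightarrow> 'a set" where
  "verts G = fst G"

definition edges :: "'a ugraph \<Rightarrow> 'a set set" where
  "edges G = snd G"

definition complete_graph :: "nat \<Rightarrow> nat ugraph" where
  "complete_graph n = ({..<n}, {e. e \<subseteq> {..<n} \<and> card e = 2})"

text \<open>The index counts edges, not vertices.\<close>

definition path_graph :: "nat \<Rightarrow> nat ugraph" where
  "path_graph m = ({..m}, {{i, Suc i} | i. i < m})"

definition subgraph :: "'a ugraph \<Rightarrow> 'a ugraph \<Rightarrow> bool" where
  "subgraph H G \<longleftrightarrow> verts H \<subseteq> verts G \<and> edges H \<subseteq> edges G"

definition isomorphic :: "'a ugraph \<Rightarrow> 'b ugraph \<Rightarrow> bool" where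
  "isomorphic G H \<longleftrightarrow> (\<exists>f. bij_betw f (verts G) (verts H) \<and> edges H = (\<lambda>e. f ` e) ` edges G)"

definition coloring3 :: "'a ugraph \<Rightarrow> ('a set \<Rightarrow> nat) \<Rightarrow> bool" where
  "coloring3 G c \<longleftrightarrow> c \<in> edges G \<rightarrow> {..<3}"

definition color_class :: "'a ugraph \<Rightarrow> ('a set \<Rightarrow> nat) \<Rightarrow> nat \<Rightarrow> 'a set set" where
  "color_class G c i = {e \<in> edges G. c e = i}"

definition balanced3 :: "'a ugraph \<Rightarrow> ('a set \<Rightarrow> nat) \<Rightarrow> bool" where
  "balanced3 G c \<longleftrightarrow> (\<forall>i<3. int (card (color_class G c i)) \<in>
     {\<lfloor>real (card (edges G)) / 3\<rfloor>, \<lceil>real (card (edges G)) / 3\<rceil>})"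

definition contains_balanced_copy :: "nat ugraph \<Rightarrow> (nat set \<Rightarrow> nat) \<Rightarrow> 'a ugraph \<Rightarrow> bool" where
  "contains_balanced_copy K c G \<longleftrightarrow> (\<exists>H. subgraph H K \<and> isomorphic G H \<and> balanced3 H c)"

definition bal3_bound :: "nat \<Rightarrow> 'a ugraph \<Rightarrow> nat \<Rightarrow> bool" where
  "bal3_bound n G m \<longleftrightarrow> (\<forall>c. coloring3 (complete_graph n) c \<longrightarrow>
     (\<forall>i<3. card (color_class (complete_graph n) c i) > m) \<longrightarrow>
     contains_balanced_copy (complete_graph n) c G)"

text \<open>
  Restricting the minimum to natural numbers loses nothing when \<open>G\<close> has at least two edges:
  a monochromatic coloring then has no balanced copy of \<open>G\<close>, so no negative bound is admissible.
\<close>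

definition bal3 :: "nat \<Rightarrow> 'a ugraph \<Rightarrow> enat" where
  "bal3 n G = (if \<exists>m. bal3_bound n G m then enat (LEAST m. bal3_bound n G m) else \<infinity>)"

end

theory Submission
  imports Defs "HOL-Library.Ramsey" "HOL-Library.Multiset"
begin

text \<open>
  Lower bound: colour the edges meeting a fixed set of \<open>k - 1\<close> vertices with two colours, evenly,
  and all other edges with the third. A path has at most \<open>2 (k - 1)\<close> edges meeting this set, while a
  balanced one needs \<open>2 k\<close>.

  Upper bound: Ramsey's theorem gives a large clique \<open>Q\<close> in one colour \<open>z\<close>. Collect vertices joined
  to \<open>Q\<close> in colour \<open>x\<close> (the set \<open>A\<close>) and in colour \<open>y\<close> (the set \<open>B\<close>), shrinking \<open>Q\<close> each time,
  until there are \<open>\<lceil>k/2\<rceil>\<close> of them or no other vertex sees much of \<open>Q\<close> in that colour. A path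
  zigzagging between \<open>Q\<close> and \<open>A \<union> B\<close> picks up two edges of the right colour per vertex. The missing
  \<open>k - 2|A|\<close> and \<open>k - 2|B|\<close> edges come from disjoint monochromatic paths outside \<open>A \<union> B\<close>, which
  exist by the Erdos--Gallai theorem because at most \<open>(|A| + |B|) n\<close> of the more than \<open>k n\<close> edges
  of each colour meet \<open>A \<union> B\<close>; these paths attach to \<open>Q\<close> at the two ends.
\<close>

section \<open>Paths in dense graphs\<close>

definition path_in :: "'a set set \<Rightarrow> 'a list \<Rightarrow> bool" where
  "path_in E p \<longleftrightarrow> distinct p \<and> successively (\<lambda>x y. {x, y} \<in> E) p"

lemma path_in_mono: "path_in E p \<Longrightarrow> E \<subseteq> F \<Longrightarrow> path_in F p"
  unfolding path_in_def by (auto elim: successively_mono)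

lemma path_in_take: "path_in E p \<Longrightarrow> path_in E (take m p)"
  unfolding path_in_def by (metis append_take_drop_id distinct_take successively_append_iff)

lemma path_in_rev: "path_in E (rev p) \<longleftrightarrow> path_in E p"
  by (simp add: path_in_def insert_commute)

lemma path_in_Cons:
  "path_in E (x # p) \<longleftrightarrow> x \<notin> set p \<and> (p = [] \<or> {x, hd p} \<in> E) \<and> path_in E p"
  by (auto simp: path_in_def successively_Cons)

lemma path_in_append:
  "path_in E (p @ q) \<longleftrightarrow> path_in E p \<and> path_in E q \<and> set p \<inter> set q = {} \<and>
     (p = [] \<or> q = [] \<or> {last p, hd q} \<in> E)"
  by (auto simp: path_in_def successively_append_iff)

lemma path_in_clique: "distinct p \<Longrightarrow> set p \<subseteq> Q \<Longrightarrow> path_in ([Q]\<^bsup>2\<^esup>) p"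
proof (induction p)
  case (Cons x p)
  then have "{x, hd p} \<in> [Q]\<^bsup>2\<^esup>" if "p \<noteq> []"
    using hd_in_set[OF that] by auto
  with Cons show ?case by (auto simp: path_in_Cons)
qed (simp add: path_in_def)

lemma finite_subset_nsets: "finite V \<Longrightarrow> E \<subseteq> [V]\<^bsup>2\<^esup> \<Longrightarrow> finite E"
  using finite_imp_finite_nsets finite_subset by blast

lemma card_incident:
  assumes "E \<subseteq> [V]\<^bsup>2\<^esup>"
  shows "card {e \<in> E. v \<in> e} = card {w. {v, w} \<in> E}"
proof -
  have "bij_betw (\<lambda>w. {v, w}) {w. {v, w} \<in> E} {e \<in> E. v \<in> e}"
    unfolding bij_betw_def
  proof
    show "inj_on (\<lambda>w. {v, w}) {w. {v, w} \<in> E}" by (auto simp: inj_on_def doubleton_eq_iff)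
    show "(\<lambda>w. {v, w}) ` {w. {v, w} \<in> E} = {e \<in> E. v \<in> e}"
    proof (intro equalityI subsetI)
      fix e assume e: "e \<in> {e \<in> E. v \<in> e}"
      then obtain a b where "e = {a, b}" using assms by (blast elim: nsets2_E)
      with e have "\<exists>w. e = {v, w}" by blast
      with e show "e \<in> (\<lambda>w. {v, w}) ` {w. {v, w} \<in> E}" by auto
    qed auto
  qed
  then show ?thesis by (simp add: bij_betw_same_card)
qed

text \<open>A longest path with enough edges at its ends closes up to a cycle on the same vertices, and
  any edge leaving this cycle would give a longer path.\<close>

lemma longest_path_closed:
  assumes E: "E \<subseteq> [V]\<^bsup>2\<^esup>"
    and p: "path_in E p" "p \<noteq> []"
    and longest: "\<And>q. path_in E q \<Longrightarrow> length q \<le> length p"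
    and deg: "card {e \<in> E. hd p \<in> e} + card {e \<in> E. last p \<in> e} \<ge> length p"
    and e: "{x, y} \<in> E" "x \<in> set p"
  shows "y \<in> set p"
proof (rule ccontr)
  assume y: "y \<notin> set p"
  define l where "l = length p - 1"
  have lp: "length p = Suc l" using p(2) by (simp add: l_def)
  have hd: "hd p = p ! 0" and la: "last p = p ! l"
    using p(2) by (auto simp: hd_conv_nth last_conv_nth l_def)
  have nhd: "w \<in> set p" if "{hd p, w} \<in> E" for w
  proof (rule ccontr)
    assume "w \<notin> set p"
    then have "path_in E (w # p)" using p that by (auto simp: path_in_Cons insert_commute)
    from longest[OF this] show False by simp
  qed
  have nla: "w \<in> set p" if "{last p, w} \<in> E" for w
  proof (rule ccontr)
    assume "w \<notin> set p"
    then have "path_in E (p @ [w])" using p that by (auto simp: path_in_append path_in_Cons) (simp add: path_in_def)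
    from longest[OF this] show False by simp
  qed
  \<comment> \<open>\<open>I\<close> collects the positions whose successor is adjacent to the first
    vertex, \<open>J\<close> those adjacent to the last vertex. There are only \<open>l\<close>
    positions, while the degrees add up to at least \<open>l + 1\<close>, so some \<open>i\<close>
    lies in both.\<close>
  define I where "I = {i. i < l \<and> {hd p, p ! Suc i} \<in> E}"
  define J where "J = {i. i < l \<and> {last p, p ! i} \<in> E}"
  have noloop: "{v} \<notin> E" for v using E by (auto simp: nsets_def)
  have "{w. {hd p, w} \<in> E} \<subseteq> (\<lambda>i. p ! Suc i) ` I"
  proof
    fix w assume w: "w \<in> {w. {hd p, w} \<in> E}"
    then obtain j where j: "j < length p" "w = p ! j" using nhd by (auto simp: in_set_conv_nth)
    then have "j \<noteq> 0" using w noloop[of "p ! 0"] hd by (intro notI) simp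
    then obtain i where "j = Suc i" using not0_implies_Suc by blast
    then show "w \<in> (\<lambda>i. p ! Suc i) ` I" using j w lp by (auto simp: I_def)
  qed
  then have cI: "card {e \<in> E. hd p \<in> e} \<le> card I"
    unfolding card_incident[OF E] by (rule surj_card_le[rotated]) (simp add: I_def)
  have "{w. {last p, w} \<in> E} \<subseteq> (\<lambda>i. p ! i) ` J"
  proof
    fix w assume w: "w \<in> {w. {last p, w} \<in> E}"
    then obtain j where j: "j < length p" "w = p ! j" using nla by (auto simp: in_set_conv_nth)
    then have "j \<noteq> l" using w noloop[of "p ! l"] la by (intro notI) simp
    then show "w \<in> (\<lambda>i. p ! i) ` J" using j w lp by (auto simp: J_def)
  qed
  then have cJ: "card {e \<in> E. last p \<in> e} \<le> card J"
    unfolding card_incident[OF E] by (rule surj_card_le[rotated]) (simp add: J_def)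
  have "I \<inter> J \<noteq> {}"
  proof
    assume "I \<inter> J = {}"
    then have "card I + card J = card (I \<union> J)" by (simp add: card_Un_disjoint I_def J_def)
    also have "\<dots> \<le> card {..<l}" by (rule card_mono) (auto simp: I_def J_def)
    finally show False using cI cJ deg lp by simp
  qed
  then obtain i where i: "i < l" "{hd p, p ! Suc i} \<in> E" "{last p, p ! i} \<in> E"
    by (auto simp: I_def J_def)
  define as bs where "as = take (Suc i) p" and "bs = drop (Suc i) p"
  have pab: "p = as @ bs" by (simp add: as_def bs_def)
  have ne: "as \<noteq> []" "bs \<noteq> []" using i lp by (auto simp: as_def bs_def)
  have las: "last as = p ! i" and hbs: "hd bs = p ! Suc i"
    using i lp by (simp_all add: as_def bs_def hd_drop_conv_nth take_Suc_conv_app_nth)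
  \<comment> \<open>From the first vertex to \<open>p ! i\<close>, across the edge to the last
    vertex, and back to \<open>p ! Suc i\<close>, which is adjacent to the first vertex: a
    Hamiltonian cycle on \<open>set p\<close>.\<close>
  define cyc where "cyc = as @ rev bs"
  have cyc: "path_in E cyc"
    using p(1) ne i(3) las unfolding cyc_def pab
    by (auto simp: path_in_append path_in_rev hd_rev insert_commute)
  have close: "{last cyc, hd cyc} \<in> E"
    using i(2) ne hbs by (simp add: cyc_def pab last_rev insert_commute)
  have scyc: "set cyc = set p" "length cyc = length p" by (auto simp: cyc_def pab)
  obtain us vs where uv: "cyc = us @ x # vs"
    using e(2) scyc(1) by (metis split_list)
  \<comment> \<open>The cycle is cut open at \<open>x\<close>, so that \<open>y\<close> can be put
    in front, which exceeds the maximal length.\<close>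
  have "path_in E (x # vs @ us)"
    using cyc close unfolding uv
    by (cases "us = []") (auto simp: path_in_append path_in_Cons split: if_splits)
  moreover have "y \<notin> set (x # vs @ us)" using y scyc(1) uv by auto
  ultimately have "path_in E (y # x # vs @ us)"
    using e(1) by (simp add: path_in_Cons insert_commute)
  from longest[OF this] show False using scyc(2) uv by simp
qed

text \<open>Induction on the number of vertices. A vertex of degree at most
  \<open>(m - 1) / 2\<close> can be deleted without losing the density. Otherwise a longest path
  either has \<open>m + 1\<close> vertices, or its ends have total degree at least its length. In
  the latter case no edge leaves its vertex set, of size \<open>s\<close> at most \<open>m\<close>;
  it spans at most \<open>s (s - 1) / 2\<close> edges, so the rest of the graph is still dense
  enough.\<close>

theorem Erdos_Gallai:
  assumes "finite V" "E \<subseteq> [V]\<^bsup>2\<^esup>" "m \<ge> 1" "2 * card E > (m - 1) * card V"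
  shows "\<exists>p. path_in E p \<and> set p \<subseteq> V \<and> length p = m + 1"
  using assms
proof (induction "card V" arbitrary: V E rule: less_induct)
  case less
  note fin = \<open>finite V\<close> and E = \<open>E \<subseteq> [V]\<^bsup>2\<^esup>\<close>
  have finE: "finite E" using fin E by (rule finite_subset_nsets)
  have sub: "\<exists>p. path_in E p \<and> set p \<subseteq> V \<and> length p = m + 1"
    if WF: "W \<subset> V" "F \<subseteq> E" "F \<subseteq> [W]\<^bsup>2\<^esup>" "2 * card F > (m - 1) * card W" for W F
  proof -
    have "card W < card V" using WF(1) fin by (simp add: psubset_card_mono)
    moreover have "finite W" using WF(1) fin by (meson finite_subset psubset_imp_subset)
    ultimately obtain p where "path_in F p" "set p \<subseteq> W" "length p = m + 1"
      using less.hyps[of W F] WF(3,4) less.prems(3) by blast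
    then show ?thesis using path_in_mono WF(1,2) by blast
  qed
  show ?case
  proof (cases "\<exists>v\<in>V. 2 * card {e \<in> E. v \<in> e} \<le> m - 1")
    case True
    then obtain v where v: "v \<in> V" "2 * card {e \<in> E. v \<in> e} \<le> m - 1" by blast
    define F where "F = {e \<in> E. v \<notin> e}"
    have "card E = card ({e \<in> E. v \<in> e} \<union> F)" by (rule arg_cong[of _ _ card]) (auto simp: F_def)
    also have "\<dots> = card {e \<in> E. v \<in> e} + card F"
      by (rule card_Un_disjoint) (use finE in \<open>auto simp: F_def\<close>)
    finally have cE: "card E = card {e \<in> E. v \<in> e} + card F" .
    have cV: "card V = Suc (card (V - {v}))" using v(1) fin by (metis card.remove)
    have "2 * card F > (m - 1) * card (V - {v})"
      using less.prems(4) v(2) unfolding cE cV by simp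
    moreover have "F \<subseteq> [V - {v}]\<^bsup>2\<^esup>" using E by (auto simp: F_def nsets_def)
    ultimately show ?thesis using v(1) by (intro sub[of "V - {v}" F]) (auto simp: F_def)
  next
    case False
    have Ene: "E \<noteq> {}" using less.prems(4) by auto
    then obtain u w where uw: "{u, w} \<in> E" "u \<in> V" "w \<in> V" "u \<noteq> w" using E by (blast elim: nsets2_E)
    \<comment> \<open>A list of one vertex is a path wherever the vertex lies; only from two
      vertices on do the edges force the path into \<open>V\<close>.\<close>
    have pV: "set p \<subseteq> V" if "path_in E p" "length p \<ge> 2" for p
    proof -
      have "set p \<subseteq> V" if "successively (\<lambda>x y. {x, y} \<in> E) p" "length p \<ge> 2" for p
        using that
      proof (induction p rule: induct_list012)
        case (3 x y zs)
        have "x \<in> V" "y \<in> V" using 3(3) E by auto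
        then show ?case using 3 by (cases zs) auto
      qed auto
      then show ?thesis using that by (simp add: path_in_def)
    qed
    define P where "P = {p. path_in E p \<and> set p \<subseteq> V}"
    have "finite P"
      by (rule finite_subset[OF _ finite_subset_distinct[OF fin]]) (auto simp: P_def path_in_def)
    moreover have uP: "[u, w] \<in> P" using uw by (auto simp: P_def path_in_def)
    ultimately have "Max (length ` P) \<in> length ` P" by (intro Max_in) auto
    then obtain p where p: "p \<in> P" "length p = Max (length ` P)" by auto
    have p: "p \<in> P" "\<And>q. q \<in> P \<Longrightarrow> length q \<le> length p"
      using p \<open>finite P\<close> by auto
    have lp: "length p \<ge> 2" using p(2)[OF uP] by simp
    then have pne: "p \<noteq> []" by auto
    have longest: "length q \<le> length p" if "path_in E q" for q
      using p(2) pV[OF that] lp that by (cases "length q \<ge> 2") (auto simp: P_def)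
    have pp: "path_in E p" "set p \<subseteq> V" using p(1) by (auto simp: P_def)
    show ?thesis
    proof (cases "length p \<ge> m + 1")
      case True
      then have "length (take (m + 1) p) = m + 1" by simp
      then show ?thesis using pp path_in_take by (metis order_trans set_take_subset)
    next
      case short: False
      have "hd p \<in> V" "last p \<in> V" using pp(2) pne by auto
      then have "\<not> 2 * card {e \<in> E. hd p \<in> e} \<le> m - 1" "\<not> 2 * card {e \<in> E. last p \<in> e} \<le> m - 1"
        using False by blast+
      then have "card {e \<in> E. hd p \<in> e} + card {e \<in> E. last p \<in> e} \<ge> length p"
        using short by linarith
      note closed = longest_path_closed[OF E pp(1) pne longest this]
      define S where "S = set p"
      define F where "F = {e \<in> E. e \<subseteq> V - S}"
      have cS: "card S = length p" using pp(1) by (simp add: S_def path_in_def distinct_card)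
      have split: "E \<subseteq> [S]\<^bsup>2\<^esup> \<union> F"
      proof
        fix e assume e: "e \<in> E"
        then obtain x y where xy: "e = {x, y}" "x \<in> V" "y \<in> V" "x \<noteq> y" using E by (blast elim: nsets2_E)
        have "x \<in> S \<longleftrightarrow> y \<in> S"
          using closed[of x y] closed[of y x] e xy(1) by (auto simp: S_def insert_commute)
        then show "e \<in> [S]\<^bsup>2\<^esup> \<union> F" using xy e by (auto simp: F_def)
      qed
      have "card E \<le> card ([S]\<^bsup>2\<^esup>) + card F"
        by (rule order_trans[OF card_mono[OF _ split] card_Un_le])
           (use finE in \<open>auto simp: F_def S_def finite_imp_finite_nsets\<close>)
      moreover have "2 * card ([S]\<^bsup>2\<^esup>) = card S * (card S - 1)"
      proof -
        have "even (card S * (card S - 1))" by (cases "card S") auto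
        then show ?thesis unfolding card_nsets choose_two by (rule dvd_mult_div_cancel)
      qed
      moreover have "card S * (card S - 1) \<le> (m - 1) * card S"
        using short cS by (subst mult.commute, intro mult_le_mono1) linarith
      moreover have "card V = card S + card (V - S)"
        using pp(2) fin by (metis S_def card_Diff_subset card_mono le_add_diff_inverse List.finite_set)
      ultimately have "2 * card F > (m - 1) * card (V - S)"
        using less.prems(4) by (simp add: algebra_simps)
      moreover have "V - S \<subset> V" using hd_in_set[OF pne] pp(2) unfolding S_def by blast
      moreover have "F \<subseteq> [V - S]\<^bsup>2\<^esup>" using E by (auto simp: F_def nsets_def)
      ultimately show ?thesis by (intro sub[of "V - S" F]) (auto simp: F_def)
    qed
  qed
qed

section \<open>Complete bipartite subgraphs and disjoint paths in two dense graphs\<close>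

text \<open>The end \<open>hd p\<close> in \<open>W\<close> carries the induction: a fresh vertex of
  \<open>W\<close> and the new vertex of \<open>S\<close> are put in front of it.\<close>

lemma zigzag_path:
  assumes "finite S" "finite W" "S \<inter> W = {}" "card S < card W"
    and "\<And>s w. s \<in> S \<Longrightarrow> w \<in> W \<Longrightarrow> {s, w} \<in> E"
  shows "\<exists>p. path_in E p \<and> length p = 2 * card S + 1 \<and> set p \<subseteq> S \<union> W \<and> hd p \<in> W"
  using assms
proof (induction S arbitrary: W rule: finite_induct)
  case empty
  then obtain w where "w \<in> W" by fastforce
  then show ?case by (intro exI[of _ "[w]"]) (auto simp: path_in_def)
next
  case (insert s S)
  then obtain w where w: "w \<in> W" by fastforce
  have "card S < card (W - {w})" using insert.prems insert.hyps w by auto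
  then obtain p where p: "path_in E p" "length p = 2 * card S + 1" "set p \<subseteq> S \<union> (W - {w})"
    "hd p \<in> W - {w}"
    using insert.IH[of "W - {w}"] insert.prems by auto
  have "w \<notin> S" "s \<notin> W" using insert.prems w by auto
  then have "path_in E (w # s # p)"
    using p insert.hyps insert.prems(4)[of s w] insert.prems(4)[of s "hd p"] w
    by (auto simp: path_in_Cons insert_commute)
  then show ?case
    using p w insert.hyps by (intro exI[of _ "w # s # p"]) auto
qed

lemma card_edges_remove_vertices:
  assumes "finite V" "E \<subseteq> [V]\<^bsup>2\<^esup>" "finite S"
  shows "card E \<le> card {e \<in> E. e \<inter> S = {}} + card S * card V"
proof -
  have finE: "finite E" using assms finite_subset_nsets by blast
  have "{e \<in> E. e \<inter> S \<noteq> {}} \<subseteq> (\<Union>s\<in>S. {e \<in> E. s \<in> e})" by auto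
  then have "card {e \<in> E. e \<inter> S \<noteq> {}} \<le> card (\<Union>s\<in>S. {e \<in> E. s \<in> e})"
    using finE assms by (intro card_mono) auto
  also have "\<dots> \<le> (\<Sum>s\<in>S. card {e \<in> E. s \<in> e})" using assms by (intro card_UN_le) auto
  also have "\<dots> \<le> (\<Sum>s\<in>S. card V)"
  proof (intro sum_mono)
    fix s
    have "{w. {s, w} \<in> E} \<subseteq> V" using assms(2) by auto
    then show "card {e \<in> E. s \<in> e} \<le> card V"
      unfolding card_incident[OF assms(2)] using assms(1) by (rule card_mono[rotated])
  qed
  finally have "card {e \<in> E. e \<inter> S \<noteq> {}} \<le> card S * card V" by simp
  moreover have "card E \<le> card {e \<in> E. e \<inter> S = {}} + card {e \<in> E. e \<inter> S \<noteq> {}}"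
    by (rule order_trans[OF _ card_Un_le], rule card_mono) (use finE in auto)
  ultimately show ?thesis by simp
qed

text \<open>A pigeonhole argument of Kovari-Sos-Turan type. Edges inside \<open>X\<close>, and edges
  to outside vertices with fewer than \<open>r\<close> neighbours in \<open>X\<close>, are covered
  by the first two terms. Hence more than \<open>2 ^ card X * M\<close> outside vertices have
  \<open>r\<close> neighbours in \<open>X\<close>, and some \<open>r\<close>-subset of
  \<open>X\<close> is shared by at least \<open>M\<close> of them.\<close>

lemma complete_bipartite_if_many_edges:
  assumes fin: "finite V" and E: "E \<subseteq> [V]\<^bsup>2\<^esup>" and X: "X \<subseteq> V"
    and many: "card {e \<in> E. e \<inter> X \<noteq> {}} > (card X)\<^sup>2 + (r - 1) * card V + 2 ^ card X * M * card X"
  obtains S W where "S \<subseteq> X" "card S = r" "W \<subseteq> V - X" "card W \<ge> M"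
    "\<And>s w. s \<in> S \<Longrightarrow> w \<in> W \<Longrightarrow> {s, w} \<in> E"
proof -
  have finX: "finite X" using X fin finite_subset by blast
  define N where "N v = {x \<in> X. {x, v} \<in> E}" for v
  define W where "W = {v \<in> V - X. card (N v) \<ge> r}"
  have finN: "finite (N v)" for v using finX by (simp add: N_def)
  have "{e \<in> E. e \<inter> X \<noteq> {}} \<subseteq> (\<lambda>(x, y). {x, y}) ` (X \<times> X \<union> (SIGMA v:V - X. N v))"
  proof
    fix e assume "e \<in> {e \<in> E. e \<inter> X \<noteq> {}}"
    then have e: "e \<in> E" "e \<inter> X \<noteq> {}" by auto
    obtain a b where ab: "e = {a, b}" "a \<in> V" "b \<in> V" using e E by (blast elim: nsets2_E)
    then obtain x y where xy: "e = {x, y}" "x \<in> X" "y \<in> V" using e(2) by (cases "a \<in> X") auto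
    show "e \<in> (\<lambda>(x, y). {x, y}) ` (X \<times> X \<union> (SIGMA v:V - X. N v))"
    proof (cases "y \<in> X")
      case False
      then have "(y, x) \<in> (SIGMA v:V - X. N v)" using xy e by (simp add: N_def)
      then show ?thesis using xy(1) by (force simp: insert_commute)
    qed (use xy in auto)
  qed
  then have "card {e \<in> E. e \<inter> X \<noteq> {}} \<le> card (X \<times> X \<union> (SIGMA v:V - X. N v))"
    using finX fin finN by (intro surj_card_le) auto
  also have "\<dots> \<le> card (X \<times> X) + card (SIGMA v:V - X. N v)" by (rule card_Un_le)
  also have "card (SIGMA v:V - X. N v) = (\<Sum>v\<in>V - X. card (N v))"
    using fin finN by (simp add: card_SigmaI)
  also have "\<dots> \<le> (\<Sum>v\<in>V - X. (r - 1) + (if v \<in> W then card X else 0))"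
  proof (intro sum_mono)
    fix v assume "v \<in> V - X"
    moreover have "card (N v) \<le> card X" using finX by (intro card_mono) (auto simp: N_def)
    ultimately show "card (N v) \<le> (r - 1) + (if v \<in> W then card X else 0)" by (auto simp: W_def)
  qed
  also have "\<dots> = (r - 1) * card (V - X) + card W * card X"
  proof -
    have "(\<Sum>v\<in>V - X. if v \<in> W then card X else 0) = (\<Sum>v\<in>(V - X) \<inter> W. card X)"
      using fin by (intro sum.inter_restrict[symmetric]) auto
    also have "(V - X) \<inter> W = W" by (auto simp: W_def)
    finally show ?thesis by (simp add: sum.distrib)
  qed
  also have "(r - 1) * card (V - X) \<le> (r - 1) * card V"
    using fin by (intro mult_left_mono card_mono) auto
  finally have "card {e \<in> E. e \<inter> X \<noteq> {}} \<le> (card X)\<^sup>2 + ((r - 1) * card V + card W * card X)"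
    by (simp add: card_cartesian_product power2_eq_square)
  then have "2 ^ card X * M * card X < card W * card X" using many by linarith
  then have big: "2 ^ card X * M < card W" by simp
  have "\<exists>S\<in>{S \<in> Pow X. card S = r}. M \<le> card {w \<in> W. S \<subseteq> N w}"
  proof (rule ccontr)
    assume "\<not> ?thesis"
    then have small: "card {w \<in> W. S \<subseteq> N w} \<le> M" if "S \<in> {S \<in> Pow X. card S = r}" for S
      using that by force
    have "W \<subseteq> (\<Union>S\<in>{S \<in> Pow X. card S = r}. {w \<in> W. S \<subseteq> N w})"
    proof
      fix w assume w: "w \<in> W"
      then obtain S where "S \<subseteq> N w" "card S = r"
        unfolding W_def by (metis (mono_tags, lifting) mem_Collect_eq obtain_subset_with_card_n)
      then show "w \<in> (\<Union>S\<in>{S \<in> Pow X. card S = r}. {w \<in> W. S \<subseteq> N w})"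
        using w by (auto simp: N_def)
    qed
    then have "card W \<le> card (\<Union>S\<in>{S \<in> Pow X. card S = r}. {w \<in> W. S \<subseteq> N w})"
      using fin finX by (intro card_mono) (auto simp: W_def)
    also have "\<dots> \<le> (\<Sum>S\<in>{S \<in> Pow X. card S = r}. card {w \<in> W. S \<subseteq> N w})"
      using finX by (intro card_UN_le) auto
    also have "\<dots> \<le> (\<Sum>S\<in>{S \<in> Pow X. card S = r}. M)" using small by (intro sum_mono)
    also have "\<dots> = card {S \<in> Pow X. card S = r} * M" by simp
    also have "\<dots> \<le> card (Pow X) * M" using finX by (intro mult_right_mono card_mono) auto
    finally show False using big finX by (simp add: card_Pow)
  qed
  then obtain S where "S \<subseteq> X" "card S = r" "M \<le> card {w \<in> W. S \<subseteq> N w}" by auto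
  then show ?thesis by (intro that[of S "{w \<in> W. S \<subseteq> N w}"]) (auto simp: W_def N_def)
qed

text \<open>If a path of the first graph meets every \<open>b\<close>-edge path of the second, then it contains about
  \<open>b/2\<close> vertices with many common neighbours in the second graph. These vertices alone already
  yield the second path, and deleting them leaves the first graph dense enough for another path.\<close>

lemma disjoint_paths:
  assumes fin: "finite V" and n: "card V \<le> n"
    and E1: "E1 \<subseteq> [V]\<^bsup>2\<^esup>" and E2: "E2 \<subseteq> [V]\<^bsup>2\<^esup>"
    and ab: "1 \<le> b" "b \<le> a"
    and c1: "2 * card E1 > (a + b) * n" and c2: "2 * card E2 > (a + b) * n"
    and large: "n \<ge> (a + 1)\<^sup>2 + 2 ^ (a + 1) * (2 * a + 3) * (a + 1)"
  shows "\<exists>p q. path_in E1 p \<and> path_in E2 q \<and> set p \<subseteq> V \<and> set q \<subseteq> V \<and> set p \<inter> set q = {} \<and>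
    length p = a + 1 \<and> length q = b + 1"
proof -
  have fin1: "finite E1" and fin2: "finite E2" using fin E1 E2 finite_subset_nsets by blast+
  have "(a - 1) * card V \<le> (a + b) * n" using n by (intro mult_mono) auto
  then obtain p where p: "path_in E1 p" "set p \<subseteq> V" "length p = a + 1"
    using Erdos_Gallai[OF fin E1, of a] ab c1 by fastforce
  define X where "X = set p"
  have X: "X \<subseteq> V" "card X = a + 1" using p by (auto simp: X_def path_in_def distinct_card)
  define F where "F = {e \<in> E2. e \<inter> X = {}}"
  have F: "F \<subseteq> [V - X]\<^bsup>2\<^esup>" using E2 by (auto simp: F_def nsets_def)
  show ?thesis
  proof (cases "\<exists>q. path_in F q \<and> set q \<subseteq> V - X \<and> length q = b + 1")
    case True
    then obtain q where "path_in F q" "set q \<subseteq> V - X" "length q = b + 1" by blast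
    moreover from this(1) have "path_in E2 q" by (rule path_in_mono) (simp add: F_def)
    ultimately show ?thesis using p by (intro exI[of _ p] exI[of _ q]) (auto simp: X_def)
  next
    case False
    \<comment> \<open>The edges of \<open>E2\<close> that avoid \<open>X\<close> are sparse by the
      contrapositive of Erdos-Gallai, so more than \<open>(a + 1) * n / 2\<close> edges meet the few
      vertices of \<open>X\<close>.\<close>
    then have "2 * card F \<le> (b - 1) * card (V - X)"
      using Erdos_Gallai[OF _ F, of b] fin ab by fastforce
    also have "\<dots> \<le> (b - 1) * n"
      using n fin by (intro mult_left_mono) (auto intro: order_trans[OF card_mono[of V]])
    finally have cF: "2 * card F \<le> (b - 1) * n" .
    have "card E2 \<le> card F + card {e \<in> E2. e \<inter> X \<noteq> {}}"
      by (rule order_trans[OF _ card_Un_le], rule card_mono) (use fin2 in \<open>auto simp: F_def\<close>)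
    moreover have "(a + b) * n = (a + 1) * n + (b - 1) * n"
      by (subst add_mult_distrib[symmetric]) (use ab in simp)
    ultimately have hit: "2 * card {e \<in> E2. e \<inter> X \<noteq> {}} > (a + 1) * n"
      using cF c2 by linarith
    \<comment> \<open>Half of \<open>b\<close>, rounded up: a zigzag through \<open>r\<close>
      vertices has at least \<open>b\<close> edges, and deleting \<open>r\<close> vertices costs at
      most \<open>(b + 1) * n / 2\<close> edges, which leaves more than
      \<open>(a - 1) * n / 2\<close> edges of \<open>E1\<close>.\<close>
    define r where "r = (b + 1) div 2"
    have r: "2 * (r - 1) \<le> a - 1" "2 * r \<le> b + 1" "b \<le> 2 * r" "r \<le> a" using ab by (auto simp: r_def)
    have "2 * ((r - 1) * card V) \<le> (a - 1) * n"
      using mult_mono[OF r(1) n] by (simp add: mult.assoc)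
    moreover have "(a - 1) * n + 2 * n = (a + 1) * n" 
      by (subst add_mult_distrib[symmetric]) (use ab in simp)
    ultimately have many: "(card X)\<^sup>2 + (r - 1) * card V + 2 ^ card X * (2 * a + 3) * card X
        < card {e \<in> E2. e \<inter> X \<noteq> {}}"
      using large hit unfolding X(2) by linarith
    \<comment> \<open>With \<open>2 * a + 3\<close> common neighbours, \<open>a + 2\<close> remain
      after the removal of an \<open>a\<close>-edge path, more than the \<open>r\<close> vertices of
      \<open>S\<close>.\<close>
    obtain S W where S: "S \<subseteq> X" "card S = r" and W: "W \<subseteq> V - X" "card W \<ge> 2 * a + 3"
      and SW: "\<And>s w. s \<in> S \<Longrightarrow> w \<in> W \<Longrightarrow> {s, w} \<in> E2"
      by (rule complete_bipartite_if_many_edges[OF fin E2 X(1) many]) (rule that)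
    have finS: "finite S" and finW: "finite W"
      using S W fin X(1) by (meson finite_subset finite_Diff)+
    \<comment> \<open>The path \<open>p\<close> is discarded. Its replacement \<open>p'\<close> only
      has to avoid \<open>S\<close>; the zigzag then takes its other vertices from \<open>W\<close>
      outside \<open>p'\<close>.\<close>
    define G where "G = {e \<in> E1. e \<inter> S = {}}"
    have G: "G \<subseteq> [V - S]\<^bsup>2\<^esup>" using E1 by (auto simp: G_def nsets_def)
    have "2 * card E1 \<le> 2 * card G + 2 * (card S * card V)"
      using card_edges_remove_vertices[OF fin E1 finS] by (simp add: G_def)
    moreover have "2 * (card S * card V) \<le> (b + 1) * n"
      using mult_mono[OF r(2) n] S(2) by (simp add: mult.assoc)
    moreover have "(a - 1) * n + (b + 1) * n = (a + b) * n" 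
      by (subst add_mult_distrib[symmetric]) (use ab in simp)
    moreover have "(a - 1) * card (V - S) \<le> (a - 1) * n"
      using n fin by (intro mult_left_mono) (auto intro: order_trans[OF card_mono[of V]])
    ultimately have "2 * card G > (a - 1) * card (V - S)" using c1 by linarith
    then obtain p' where p': "path_in G p'" "set p' \<subseteq> V - S" "length p' = a + 1"
      using Erdos_Gallai[OF _ G, of a] fin ab by auto
    have "card (set p') \<le> a + 1" using p'(3) card_length[of p'] by simp
    then have "card S < card (W - set p')"
      using diff_card_le_card_Diff[of "set p'" W] W(2) S(2) r(4) by simp
    then obtain q where q: "path_in E2 q" "length q = 2 * card S + 1" "set q \<subseteq> S \<union> (W - set p')"
      using zigzag_path[of S "W - set p'" E2] finS finW S W SW by auto
    have "set (take (b + 1) q) \<subseteq> S \<union> (W - set p')" using q(3) set_take_subset by fast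
    moreover have "length (take (b + 1) q) = b + 1" using q(2) S(2) r(3) by simp
    moreover have "path_in E1 p'" using p'(1) by (rule path_in_mono) (simp add: G_def)
    ultimately show ?thesis using p' path_in_take[OF q(1)] S(1) W(1) X(1)
      by (intro exI[of _ p'] exI[of _ "take (b + 1) q"]) blast
  qed
qed

section \<open>Building balanced paths from a monochromatic clique\<close>

text \<open>As a multiset, the colours of a concatenation are the sum of both parts plus the colour
  of the joining edge, and balance is a single multiset equation.\<close>

fun edge_colors :: "('a set \<Rightarrow> nat) \<Rightarrow> 'a list \<Rightarrow> nat multiset" where
  "edge_colors c (x # y # p) = add_mset (c {x, y}) (edge_colors c (y # p))"
| "edge_colors c p = {#}"

lemma edge_colors_Cons: "p \<noteq> [] \<Longrightarrow> edge_colors c (x # p) = add_mset (c {x, hd p}) (edge_colors c p)"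
  by (cases p) auto

lemma edge_colors_append:
  "p \<noteq> [] \<Longrightarrow> q \<noteq> [] \<Longrightarrow>
     edge_colors c (p @ q) = edge_colors c p + edge_colors c q + {#c {last p, hd q}#}"
  by (induction p rule: induct_list012) (auto simp: edge_colors_Cons)

lemma size_edge_colors: "size (edge_colors c p) = length p - 1"
  by (induction c p rule: edge_colors.induct) auto

lemma edge_colors_monochromatic:
  "path_in E p \<Longrightarrow> (\<And>e. e \<in> E \<Longrightarrow> c e = i) \<Longrightarrow> edge_colors c p = replicate_mset (length p - 1) i"
  by (induction p rule: induct_list012) (auto simp: path_in_Cons)

text \<open>Each vertex of \<open>S\<close> is threaded between two vertices of \<open>Q\<close> and
  contributes its colour twice; \<open>j\<close> further edges are spent inside the clique. Both
  ends stay in \<open>Q\<close> so that other paths can be attached. The function \<open>f\<close>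
  treats the vertices of \<open>A\<close> and \<open>B\<close> together.\<close>

lemma connector_path:
  assumes "finite S" "finite Q" "S \<inter> Q = {}" "card S + j < card Q"
    and "\<And>s q. s \<in> S \<Longrightarrow> q \<in> Q \<Longrightarrow> c {s, q} = f s"
    and "\<And>e. e \<in> [Q]\<^bsup>2\<^esup> \<Longrightarrow> c e = z"
  shows "\<exists>p. p \<noteq> [] \<and> distinct p \<and> set p \<subseteq> S \<union> Q \<and> hd p \<in> Q \<and> last p \<in> Q \<and>
    edge_colors c p = repeat_mset 2 (image_mset f (mset_set S)) + replicate_mset j z"
  using assms
proof (induction S arbitrary: Q rule: finite_induct)
  case empty
  then obtain R where R: "R \<subseteq> Q" "card R = Suc j"
    by (metis Suc_leI add_0 card.empty obtain_subset_with_card_n)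
  then obtain p where p: "set p = R" "distinct p"
    using empty.prems(1) finite_distinct_list finite_subset by metis
  then have lp: "length p = Suc j" using R by (simp add: distinct_card flip: p(1))
  have "path_in ([Q]\<^bsup>2\<^esup>) p" using p R(1) by (simp add: path_in_clique)
  then have "edge_colors c p = replicate_mset j z"
    using edge_colors_monochromatic[of "[Q]\<^bsup>2\<^esup>" p c z] empty.prems(5) lp by simp
  moreover have "p \<noteq> []" using lp by auto
  ultimately show ?case using p R by (intro exI[of _ p]) auto
next
  case (insert s S)
  then obtain w where w: "w \<in> Q" by fastforce
  have "S \<inter> (Q - {w}) = {}" "\<And>e. e \<in> [Q - {w}]\<^bsup>2\<^esup> \<Longrightarrow> c e = z" "card S + j < card (Q - {w})"
    using insert.prems insert.hyps w by (auto simp: nsets_def)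
  then obtain p where p: "p \<noteq> []" "distinct p" "set p \<subseteq> S \<union> (Q - {w})" "hd p \<in> Q - {w}"
      "last p \<in> Q - {w}" "edge_colors c p = repeat_mset 2 (image_mset f (mset_set S)) + replicate_mset j z"
    using insert.IH[of "Q - {w}"] insert.prems(1,4) by blast
  have "w \<notin> S" "s \<notin> Q" using insert.prems w by auto
  then have "distinct (w # s # p)" using p insert.hyps w by auto
  moreover have "edge_colors c (w # s # p)
      = repeat_mset 2 (image_mset f (mset_set (insert s S))) + replicate_mset j z"
    using p insert.hyps insert.prems(4)[of s w] insert.prems(4)[of s "hd p"] w
    by (simp add: edge_colors_Cons insert_commute numeral_2_eq_2)
  ultimately show ?case
    using p w by (intro exI[of _ "w # s # p"]) auto
qed

definition clique_system ::
    "('a set \<Rightarrow> nat) \<Rightarrow> nat \<Rightarrow> nat \<Rightarrow> nat \<Rightarrow> 'a set \<Rightarrow> 'a set \<Rightarrow> 'a set \<Rightarrow> bool" where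
  "clique_system c x y z A B Q \<longleftrightarrow>
     finite A \<and> finite B \<and> finite Q \<and> A \<inter> B = {} \<and> A \<inter> Q = {} \<and> B \<inter> Q = {} \<and>
     (\<forall>a\<in>A. \<forall>q\<in>Q. c {a, q} = x) \<and> (\<forall>b\<in>B. \<forall>q\<in>Q. c {b, q} = y) \<and> (\<forall>e\<in>[Q]\<^bsup>2\<^esup>. c e = z)"

lemma clique_system_subset:
  assumes "clique_system c x y z A B Q" "A' \<subseteq> A" "B' \<subseteq> B" "Q' \<subseteq> Q"
  shows "clique_system c x y z A' B' Q'"
proof -
  have "[Q']\<^bsup>2\<^esup> \<subseteq> [Q]\<^bsup>2\<^esup>" using assms(4) by (rule nsets_mono)
  then show ?thesis
    using assms unfolding clique_system_def by (blast intro: finite_subset)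
qed

lemma clique_system_swap: "clique_system c x y z A B Q \<longleftrightarrow> clique_system c y x z B A Q"
  unfolding clique_system_def by auto

lemma clique_system_path:
  assumes sys: "clique_system c x y z A B Q" and card: "card A + card B + j < card Q"
  obtains p where "p \<noteq> []" "distinct p" "set p \<subseteq> A \<union> B \<union> Q" "hd p \<in> Q" "last p \<in> Q"
    "edge_colors c p = replicate_mset (2 * card A) x + replicate_mset (2 * card B) y + replicate_mset j z"
proof -
  define f where "f s = (if s \<in> A then x else y)" for s
  have AB: "finite A" "finite B" "A \<inter> B = {}" using sys by (auto simp: clique_system_def)
  have cAB: "card (A \<union> B) = card A + card B" using AB by (simp add: card_Un_disjoint)
  have "image_mset f (mset_set A) = image_mset (\<lambda>_. x) (mset_set A)"
    using AB(1) by (intro image_mset_cong) (simp add: f_def)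
  moreover have "image_mset f (mset_set B) = image_mset (\<lambda>_. y) (mset_set B)"
    using AB by (intro image_mset_cong) (auto simp: f_def)
  ultimately have "repeat_mset 2 (image_mset f (mset_set (A \<union> B)))
      = replicate_mset (2 * card A) x + replicate_mset (2 * card B) y"
    using AB by (simp add: mset_set_Union image_mset_const_eq multiset_eq_iff)
  moreover have "\<exists>p. p \<noteq> [] \<and> distinct p \<and> set p \<subseteq> A \<union> B \<union> Q \<and> hd p \<in> Q \<and> last p \<in> Q \<and>
    edge_colors c p = repeat_mset 2 (image_mset f (mset_set (A \<union> B))) + replicate_mset j z"
    using sys card cAB by (intro connector_path) (auto simp: clique_system_def f_def)
  ultimately show ?thesis using that by auto
qed

text \<open>For odd \<open>t\<close> the last edge of colour \<open>y\<close> comes from a spare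
  vertex of \<open>B\<close> appended as the end of the path. Therefore only the front end is
  guaranteed to lie in \<open>Q\<close>.\<close>

lemma clique_system_open_path:
  assumes sys: "clique_system c x y z A B Q" and card: "card A + card B + j < card Q"
    and t: "t \<le> 2 * card B"
  obtains p where "p \<noteq> []" "distinct p" "set p \<subseteq> A \<union> B \<union> Q" "hd p \<in> Q"
    "edge_colors c p = replicate_mset (2 * card A) x + replicate_mset t y + replicate_mset j z"
proof -
  have "t div 2 \<le> card B" using t by simp
  then obtain B' where B': "B' \<subseteq> B" "card B' = t div 2" by (metis obtain_subset_with_card_n)
  have "clique_system c x y z A B' Q" using clique_system_subset[OF sys] B' by simp
  moreover have "card A + card B' + j < card Q" using card B' \<open>t div 2 \<le> card B\<close> by simp
  ultimately obtain p where p: "p \<noteq> []" "distinct p" "set p \<subseteq> A \<union> B' \<union> Q" "hd p \<in> Q" "last p \<in> Q"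
    "edge_colors c p = replicate_mset (2 * card A) x + replicate_mset (2 * (t div 2)) y + replicate_mset j z"
    using B'(2) by (metis clique_system_path)
  show ?thesis
  proof (cases "even t")
    case True
    then show ?thesis using p B' by (intro that[of p]) auto
  next
    case False
    then have "card B' < card B" using t B' by presburger
    then have "B' \<noteq> B" by auto
    then obtain b where b: "b \<in> B" "b \<notin> B'" using B'(1) by blast
    then have "b \<notin> set p" using p(3) sys by (auto simp: clique_system_def)
    moreover have "c {last p, b} = y" using p(5) b sys by (simp add: clique_system_def insert_commute)
    moreover have "replicate_mset t y = add_mset y (replicate_mset (2 * (t div 2)) y)"
      using False by (metis odd_two_times_div_two_succ replicate_mset_Suc Suc_eq_plus1)
    ultimately show ?thesis
      using p b B' by (intro that[of "p @ [b]"]) (auto simp: edge_colors_append)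
  qed
qed

section \<open>Balanced paths, by the sizes of \<open>A\<close> and \<open>B\<close>\<close>

text \<open>The sum over a set of colours makes the notion symmetric, so the roles of the colours
  can be permuted freely.\<close>

definition has_balanced_path :: "('a set \<Rightarrow> nat) \<Rightarrow> 'a set \<Rightarrow> nat set \<Rightarrow> nat \<Rightarrow> bool" where
  "has_balanced_path c V C k \<longleftrightarrow> (\<exists>p. p \<noteq> [] \<and> distinct p \<and> set p \<subseteq> V \<and>
     edge_colors c p = (\<Sum>i\<in>C. replicate_mset k i))"

lemma has_balanced_pathI:
  assumes "p \<noteq> []" "distinct p" "set p \<subseteq> V" "x \<noteq> y" "x \<noteq> z" "y \<noteq> z"
    "edge_colors c p = replicate_mset k x + replicate_mset k y + replicate_mset k z"
  shows "has_balanced_path c V {x, y, z} k"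
  using assms unfolding has_balanced_path_def by (intro exI[of _ p]) (auto simp: add_ac)

text \<open>No outside path is needed. For even \<open>k\<close> the zigzag gives exactly
  \<open>k\<close> edges of each colour. For odd \<open>k\<close> one vertex of \<open>A\<close> and
  one of \<open>B\<close> serve as ends of the path, each contributing a single edge.\<close>

lemma balanced_path_both_large:
  assumes sys: "clique_system c x y z A B Q" and V: "A \<union> B \<union> Q \<subseteq> V"
    and xyz: "x \<noteq> y" "x \<noteq> z" "y \<noteq> z"
    and cA: "card A = (k + 1) div 2" and cB: "card B = (k + 1) div 2" and cQ: "card Q \<ge> 50 * k" and k: "k \<ge> 1"
  shows "has_balanced_path c V {x, y, z} k"
proof (cases "even k")
  case True
  then have h: "2 * card A = k" "2 * card B = k" using cA cB by auto
  have "card A + card B + k < card Q" using h cQ k by linarith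
  from clique_system_path[OF sys this]
  obtain p where "p \<noteq> []" "distinct p" "set p \<subseteq> A \<union> B \<union> Q"
    "edge_colors c p = replicate_mset k x + replicate_mset k y + replicate_mset k z"
    unfolding h by metis
  then show ?thesis using V xyz by (intro has_balanced_pathI[of p]) auto
next
  case False
  have finA: "finite A" using sys by (simp add: clique_system_def)
  have "card A > 0" using cA k by simp
  then obtain a where a: "a \<in> A" by fastforce
  have cA': "card (A - {a}) = k div 2" using a finA cA False by (simp add: card_Diff_singleton)
  have "clique_system c x y z (A - {a}) B Q" using clique_system_subset[OF sys] by auto
  moreover have "card (A - {a}) + card B + k < card Q" using cA' cB cQ k by simp
  moreover have "k \<le> 2 * card B" using cB by simp
  ultimately obtain p where p: "p \<noteq> []" "distinct p" "set p \<subseteq> A - {a} \<union> B \<union> Q" "hd p \<in> Q"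
    "edge_colors c p = replicate_mset (2 * card (A - {a})) x + replicate_mset k y + replicate_mset k z"
    by (rule clique_system_open_path) blast
  have "a \<notin> set p" using a p(3) sys by (auto simp: clique_system_def)
  moreover have "c {a, hd p} = x" using a p(4) sys by (simp add: clique_system_def)
  moreover have "replicate_mset k x = add_mset x (replicate_mset (2 * card (A - {a})) x)"
    unfolding cA' using False by (metis odd_two_times_div_two_succ replicate_mset_Suc Suc_eq_plus1)
  ultimately show ?thesis
    using p V a xyz by (intro has_balanced_pathI[of "a # p"]) (auto simp: edge_colors_Cons)
qed

text \<open>The missing \<open>k - 2 * card A\<close> edges of colour \<open>x\<close> form a path
  outside \<open>A\<close> and \<open>B\<close>. Its last vertex sees little of \<open>Q\<close> in
  colour \<open>x\<close>, hence much of it in \<open>y\<close> or in \<open>z\<close>; whichever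
  colour the joining edge has is saved in the rest of the path.\<close>

lemma balanced_path_one_large:
  assumes fin: "finite V" and col: "\<And>e. e \<in> [V]\<^bsup>2\<^esup> \<Longrightarrow> c e \<in> {x, y, z}"
    and sys: "clique_system c x y z A B Q" and V: "A \<union> B \<union> Q \<subseteq> V"
    and xyz: "x \<noteq> y" "x \<noteq> z" "y \<noteq> z"
    and cA: "card A < (k + 1) div 2" and cB: "card B = (k + 1) div 2"
    and cQ: "card Q \<ge> 50 * k" and k: "k \<ge> 1"
    and few: "\<And>v. v \<in> V - A - B \<Longrightarrow> 5 * card {q \<in> Q - {v}. c {v, q} = x} \<le> card Q"
    and many: "card {e \<in> [V]\<^bsup>2\<^esup>. c e = x} > k * card V"
  shows "has_balanced_path c V {x, y, z} k"
proof -
  have finABQ: "finite A" "finite B" "finite Q" and disj: "A \<inter> B = {}"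
    using sys by (auto simp: clique_system_def)
  have cAB: "card (A \<union> B) = card A + card B" using finABQ disj by (simp add: card_Un_disjoint)
  define W where "W = V - (A \<union> B)"
  define E where "E = {e \<in> [V]\<^bsup>2\<^esup>. c e = x}"
  define F where "F = {e \<in> E. e \<inter> (A \<union> B) = {}}"
  have E: "E \<subseteq> [V]\<^bsup>2\<^esup>" by (auto simp: E_def)
  have F: "F \<subseteq> [W]\<^bsup>2\<^esup>" using E by (auto simp: F_def nsets_def W_def)
  have "card E \<le> card F + (card A + card B) * card V"
    using card_edges_remove_vertices[OF fin E, of "A \<union> B"] finABQ cAB by (simp add: F_def)
  \<comment> \<open>Up to the factor \<open>card V\<close>, this bounds twice the edges lost at
    \<open>A\<close> and \<open>B\<close> plus the Erdos-Gallai threshold for the missing path; it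
    comes down to \<open>2 * card B + k - 1\<close> being at most \<open>2 * k\<close>.\<close>
  moreover have "2 * ((card A + card B) * card V) + (k - 2 * card A - 1) * card V \<le> 2 * (k * card V)"
  proof -
    have "2 * card B \<le> k + 1" "2 * card A + 1 \<le> k" using cA cB by auto
    then have "2 * (card A + card B) + (k - 2 * card A - 1) \<le> 2 * k" by (simp add: distrib_left)
    then have "(2 * (card A + card B) + (k - 2 * card A - 1)) * card V \<le> 2 * k * card V" by (rule mult_le_mono1)
    then show ?thesis by (simp add: algebra_simps)
  qed
  moreover have "(k - 2 * card A - 1) * card W \<le> (k - 2 * card A - 1) * card V"
    using fin by (intro mult_le_mono2 card_mono) (auto simp: W_def)
  ultimately have "2 * card F > (k - 2 * card A - 1) * card W"
    using many unfolding E_def[symmetric] by linarith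
  moreover have kA: "k - 2 * card A \<ge> 1" using cA by linarith
  ultimately obtain p where p: "path_in F p" "set p \<subseteq> W" "length p = k - 2 * card A + 1"
    using Erdos_Gallai[OF _ F, of "k - 2 * card A"] fin W_def by blast
  have pne: "p \<noteq> []" using p(3) by auto
  have pc: "edge_colors c p = replicate_mset (k - 2 * card A) x"
    using edge_colors_monochromatic[OF p(1), of c x] p(3) by (simp add: F_def E_def)
  define v where "v = last p"
  have v: "v \<in> set p" "v \<in> V - A - B" using last_in_set[OF pne] p(2) by (auto simp: v_def W_def)
  define U where "U i = {q \<in> Q - set p. c {v, q} = i}" for i
  have "Q - set p \<subseteq> U y \<union> U z \<union> {q \<in> Q - {v}. c {v, q} = x}"
  proof
    fix q assume q: "q \<in> Q - set p"
    then have "{v, q} \<in> [V]\<^bsup>2\<^esup>" using v V by auto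
    from col[OF this] show "q \<in> U y \<union> U z \<union> {q \<in> Q - {v}. c {v, q} = x}"
      using q v(1) by (auto simp: U_def)
  qed
  then have "card (Q - set p) \<le> card (U y \<union> U z \<union> {q \<in> Q - {v}. c {v, q} = x})"
    using finABQ by (intro card_mono) (auto simp: U_def)
  also have "\<dots> \<le> card (U y) + card (U z) + card {q \<in> Q - {v}. c {v, q} = x}"
    by (meson add_le_mono1 card_Un_le order_trans)
  finally have "card Q \<le> k + 1 + card (U y) + card (U z) + card {q \<in> Q - {v}. c {v, q} = x}"
    using diff_card_le_card_Diff[of "set p" Q] card_length[of p] p(3) by simp
  \<comment> \<open>At least \<open>4/5\<close> of the \<open>50 * k\<close> clique vertices, less
    the at most \<open>k + 1\<close> on \<open>p\<close>, are split between \<open>U y\<close> and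
    \<open>U z\<close>, while the zigzag asks for more than at most \<open>2 * k\<close>.\<close>
  then have "card (U y) > card A + card B + k \<or> card (U z) > card A + card B + k"
    using few[OF v(2)] cA cB cQ k by linarith
  then obtain i where i: "i = y \<or> i = z" "card A + card B + k < card (U i)" by blast
  \<comment> \<open>The joining edge has colour \<open>i\<close>, so that colour is used once less
    in \<open>r\<close>.\<close>
  define t j where "t = (if i = y then k - 1 else k)" and "j = (if i = y then k else k - 1)"
  have "clique_system c x y z A B (U i)" using clique_system_subset[OF sys] by (auto simp: U_def)
  moreover have "card A + card B + j < card (U i)" using i by (auto simp: j_def)
  moreover have "t \<le> 2 * card B" using cB by (auto simp: t_def)
  ultimately obtain r where r: "r \<noteq> []" "distinct r" "set r \<subseteq> A \<union> B \<union> U i" "hd r \<in> U i"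
    "edge_colors c r = replicate_mset (2 * card A) x + replicate_mset t y + replicate_mset j z"
    by (rule clique_system_open_path)
  have "distinct (p @ r)" using p r by (auto simp: path_in_def W_def U_def)
  moreover have "set (p @ r) \<subseteq> V" using p r V by (auto simp: W_def U_def)
  moreover have "edge_colors c (p @ r) = replicate_mset k x + replicate_mset k y + replicate_mset k z"
  proof -
    have "c {last p, hd r} = i" using r(4) by (simp add: U_def v_def)
    then have "edge_colors c (p @ r) = (replicate_mset (k - 2 * card A) x + replicate_mset (2 * card A) x)
        + (replicate_mset t y + replicate_mset j z + {#i#})"
      using pne r(1) by (simp add: edge_colors_append pc r(5))
    also have "replicate_mset (k - 2 * card A) x + replicate_mset (2 * card A) x = replicate_mset k x"
      using kA by (simp add: multiset_eq_iff)
    also have "replicate_mset t y + replicate_mset j z + {#i#} = replicate_mset k y + replicate_mset k z"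
      using i(1) k xyz by (cases k) (auto simp: t_def j_def)
    finally show ?thesis by (simp add: add.assoc)
  qed
  ultimately show ?thesis using pne xyz by (intro has_balanced_pathI[of "p @ r"]) auto
qed

text \<open>Each of \<open>v\<close> and \<open>w\<close> sees at most a fifth of \<open>Q\<close>
  in \<open>x\<close> and at most a fifth in \<open>y\<close>. These four sets leave at least a
  fifth of \<open>Q\<close>, up to \<open>T\<close>, joined to both vertices in colour
  \<open>z\<close>.\<close>

lemma clique_neighbor:
  assumes col: "\<And>e. e \<in> [V]\<^bsup>2\<^esup> \<Longrightarrow> c e \<in> {x, y, z}" and "finite Q" "Q \<subseteq> V"
    and v: "v \<in> V" and w: "w \<in> V" and T: "finite T" "v \<in> T" "w \<in> T"
    and few: "\<And>u i. u \<in> {v, w} \<Longrightarrow> i \<in> {x, y} \<Longrightarrow> 5 * card {q \<in> Q - {u}. c {u, q} = i} \<le> card Q"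
  shows "card Q \<le> 5 * card {q \<in> Q - T. c {v, q} = z \<and> c {w, q} = z} + 5 * card T"
proof -
  define U where "U = {q \<in> Q - T. c {v, q} = z \<and> c {w, q} = z}"
  define N where "N u i = {q \<in> Q - {u}. c {u, q} = i}" for u i
  have "Q - T \<subseteq> U \<union> (N v x \<union> N v y \<union> (N w x \<union> N w y))"
  proof
    fix q assume q: "q \<in> Q - T"
    then have "{v, q} \<in> [V]\<^bsup>2\<^esup>" "{w, q} \<in> [V]\<^bsup>2\<^esup>" using assms by auto
    from col[OF this(1)] col[OF this(2)]
    show "q \<in> U \<union> (N v x \<union> N v y \<union> (N w x \<union> N w y))" using q T by (auto simp: U_def N_def)
  qed
  then have "card (Q - T) \<le> card (U \<union> (N v x \<union> N v y \<union> (N w x \<union> N w y)))"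
    using \<open>finite Q\<close> by (intro card_mono) (auto simp: U_def N_def)
  also have "\<dots> \<le> card U + (card (N v x) + card (N v y) + (card (N w x) + card (N w y)))"
    by (intro order_trans[OF card_Un_le] add_mono order_refl)
  finally have "card (Q - T) \<le> \<dots>" .
  moreover have "card Q \<le> card (Q - T) + card T"
    using diff_card_le_card_Diff[of T Q] T(1) by simp
  moreover have "5 * card (N v x) \<le> card Q" "5 * card (N v y) \<le> card Q"
    "5 * card (N w x) \<le> card Q" "5 * card (N w y) \<le> card Q" using few by (auto simp: N_def)
  ultimately show ?thesis unfolding U_def[symmetric] by linarith
qed

text \<open>The case \<open>k = 1\<close>, where a path joined to the clique at both ends would
  already have two edges of colour \<open>z\<close>. If an \<open>x\<close>-edge and a
  \<open>y\<close>-edge share a vertex, a \<open>z\<close>-edge is appended. If not, any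
  \<open>x\<close>-edge and any \<open>y\<close>-edge are disjoint and every edge between them has
  colour \<open>z\<close>.\<close>

lemma rainbow_path:
  assumes col: "\<And>e. e \<in> [V]\<^bsup>2\<^esup> \<Longrightarrow> c e \<in> {x, y, z}"
    and xyz: "x \<noteq> y" "x \<noteq> z" "y \<noteq> z"
    and ex: "{e \<in> [V]\<^bsup>2\<^esup>. c e = x} \<noteq> {}" and ey: "{e \<in> [V]\<^bsup>2\<^esup>. c e = y} \<noteq> {}"
    and nb: "\<And>v T. v \<in> V \<Longrightarrow> v \<in> T \<Longrightarrow> finite T \<Longrightarrow> card T \<le> 3 \<Longrightarrow> \<exists>q \<in> V - T. c {v, q} = z"
  shows "has_balanced_path c V {x, y, z} 1"
proof (cases "\<exists>u v w. {u, v, w} \<subseteq> V \<and> u \<noteq> v \<and> v \<noteq> w \<and> c {u, v} = x \<and> c {v, w} = y")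
  case True
  then obtain u v w where uvw: "{u, v, w} \<subseteq> V" "u \<noteq> v" "v \<noteq> w" "c {u, v} = x" "c {v, w} = y" by blast
  then have "u \<noteq> w" using xyz by (auto simp: insert_commute)
  have "card {u, v, w} \<le> 3" by (simp add: card_insert_if)
  then obtain q where "q \<in> V - {u, v, w}" "c {w, q} = z" using nb[of w "{u, v, w}"] uvw by auto
  then show ?thesis
    using uvw \<open>u \<noteq> w\<close> xyz by (intro has_balanced_pathI[of "[u, v, w, q]"]) auto
next
  case False
  obtain u v where uv: "u \<in> V" "v \<in> V" "u \<noteq> v" "c {u, v} = x" using ex by (blast elim: nsets2_E)
  obtain s t where st: "s \<in> V" "t \<in> V" "s \<noteq> t" "c {s, t} = y" using ey by (blast elim: nsets2_E)
  \<comment> \<open>The next lines apply this to the four ways in which the two edges could share a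
    vertex, and then to the edge \<open>{v, s}\<close>.\<close>
  have F: "\<not> (c {a, b} = x \<and> c {b, d} = y)" if "{a, b, d} \<subseteq> V" "a \<noteq> b" "b \<noteq> d" for a b d
    using False that by blast
  have "v \<noteq> s" using F[of u v t] uv st by auto
  have "u \<noteq> s" using F[of v u t] uv st by (auto simp: insert_commute)
  have "v \<noteq> t" using F[of u v s] uv st by (auto simp: insert_commute)
  have "u \<noteq> t" using F[of v u s] uv st by (auto simp: insert_commute)
  have "c {v, s} \<noteq> x" using F[of v s t] uv st \<open>v \<noteq> s\<close> by auto
  moreover have "c {v, s} \<noteq> y" using F[of u v s] uv st \<open>v \<noteq> s\<close> by auto
  ultimately have "c {v, s} = z" using col[of "{v, s}"] uv st \<open>v \<noteq> s\<close> by auto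
  then show ?thesis
    using uv st \<open>v \<noteq> s\<close> \<open>u \<noteq> s\<close> \<open>v \<noteq> t\<close> \<open>u \<noteq> t\<close> xyz
    by (intro has_balanced_pathI[of "[u, v, s, t]"]) auto
qed

text \<open>Disjoint paths supply the missing edges of colours \<open>x\<close> and
  \<open>y\<close>. Both attach by \<open>z\<close>-edges to a zigzag inside the set of clique
  vertices that their ends see in \<open>z\<close>, so the zigzag itself spends \<open>k - 2\<close>
  edges of colour \<open>z\<close>; \<open>k = 1\<close> is treated separately.\<close>

lemma balanced_path_both_small:
  assumes fin: "finite V" and col: "\<And>e. e \<in> [V]\<^bsup>2\<^esup> \<Longrightarrow> c e \<in> {x, y, z}"
    and sys: "clique_system c x y z A B Q" and V: "A \<union> B \<union> Q \<subseteq> V"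
    and xyz: "x \<noteq> y" "x \<noteq> z" "y \<noteq> z"
    and cA: "card A < (k + 1) div 2" and cB: "card B \<le> card A"
    and cQ: "card Q \<ge> 50 * k" and k: "k \<ge> 1"
    and few: "\<And>v i. v \<in> V - A - B \<Longrightarrow> i \<in> {x, y} \<Longrightarrow> 5 * card {q \<in> Q - {v}. c {v, q} = i} \<le> card Q"
    and manyx: "card {e \<in> [V]\<^bsup>2\<^esup>. c e = x} > k * card V"
    and manyy: "card {e \<in> [V]\<^bsup>2\<^esup>. c e = y} > k * card V"
    and large: "card V \<ge> (k + 1)\<^sup>2 + 2 ^ (k + 1) * (2 * k + 3) * (k + 1)"
  shows "has_balanced_path c V {x, y, z} k"
proof -
  have finABQ: "finite A" "finite B" "finite Q" and disj: "A \<inter> B = {}"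
    using sys by (auto simp: clique_system_def)
  show ?thesis
  proof (cases "k = 1")
    case True
    have AB: "A = {}" "B = {}" using True cA cB finABQ by auto
    have "{e \<in> [V]\<^bsup>2\<^esup>. c e = x} \<noteq> {}" "{e \<in> [V]\<^bsup>2\<^esup>. c e = y} \<noteq> {}"
      using manyx manyy by (metis card.empty not_less_zero)+
    moreover have "\<exists>q \<in> V - T. c {v, q} = z" if "v \<in> V" "v \<in> T" "finite T" "card T \<le> 3" for v T
    proof -
      have "card Q \<le> 5 * card {q \<in> Q - T. c {v, q} = z \<and> c {v, q} = z} + 5 * card T"
        by (rule clique_neighbor[where V = V, OF col]) (use finABQ V that few AB in auto)
      then have "card {q \<in> Q - T. c {v, q} = z \<and> c {v, q} = z} \<noteq> 0"
        using that(4) cQ True by linarith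
      then have "{q \<in> Q - T. c {v, q} = z \<and> c {v, q} = z} \<noteq> {}" by (metis card.empty)
      then show ?thesis using V by blast
    qed
    ultimately show ?thesis unfolding True using col xyz by (intro rainbow_path)
  next
    case False
    have cAB: "card (A \<union> B) = card A + card B" using finABQ disj by (simp add: card_Un_disjoint)
    define W where "W = V - (A \<union> B)"
    define E where "E i = {e \<in> [V]\<^bsup>2\<^esup>. c e = i}" for i
    define F where "F i = {e \<in> E i. e \<inter> (A \<union> B) = {}}" for i
    have E: "E i \<subseteq> [V]\<^bsup>2\<^esup>" for i by (auto simp: E_def)
    have F: "F i \<subseteq> [W]\<^bsup>2\<^esup>" for i using E[of i] by (auto simp: F_def nsets_def W_def)
    define a b where "a = k - 2 * card A" and "b = k - 2 * card B"
    have ab: "1 \<le> a" "a \<le> b" "b \<le> k" using cA cB by (auto simp: a_def b_def)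
    have Fbig: "2 * card (F i) > (b + a) * card V" if "card (E i) > k * card V" for i
    proof -
      have "card (E i) \<le> card (F i) + (card A + card B) * card V"
        using card_edges_remove_vertices[OF fin E, of "A \<union> B"] finABQ cAB by (simp add: F_def)
      \<comment> \<open>An equality: after deleting \<open>A\<close> and \<open>B\<close>, the bound
        \<open>k * card V\<close> is exactly the density required by
        \<open>disjoint_paths\<close>.\<close>
      moreover have "2 * (k * card V) = 2 * ((card A + card B) * card V) + (b + a) * card V"
      proof -
        have "2 * k = 2 * (card A + card B) + (b + a)" using cA cB by (simp add: a_def b_def)
        then show ?thesis by (metis add_mult_distrib mult.assoc)
      qed
      ultimately show ?thesis using that by linarith
    qed
    have "(b + 1)\<^sup>2 + 2 ^ (b + 1) * (2 * b + 3) * (b + 1) \<le> (k + 1)\<^sup>2 + 2 ^ (k + 1) * (2 * k + 3) * (k + 1)"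
      using ab(3) by (intro add_mono mult_mono power_mono power_increasing) auto
    then have large': "(b + 1)\<^sup>2 + 2 ^ (b + 1) * (2 * b + 3) * (b + 1) \<le> card V" using large by linarith
    have W: "finite W" "card W \<le> card V" using fin by (auto simp: W_def intro: card_mono)
    have Fx: "2 * card (F x) > (b + a) * card V" and Fy: "2 * card (F y) > (b + a) * card V"
      using Fbig manyx manyy by (auto simp: E_def)
    \<comment> \<open>The first graph of \<open>disjoint_paths\<close> receives the longer path.
      Since \<open>card B\<close> is at most \<open>card A\<close>, that is the path of colour
      \<open>y\<close>.\<close>
    obtain q p where p: "path_in (F x) p" "set p \<subseteq> W" "length p = a + 1"
      and q: "path_in (F y) q" "set q \<subseteq> W" "length q = b + 1" and pq: "set q \<inter> set p = {}"
      using disjoint_paths[OF W F F ab(1,2) Fy Fx large'] by blast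
    have ne: "p \<noteq> []" "q \<noteq> []" using p(3) q(3) by auto
    have pc: "edge_colors c p = replicate_mset a x"
      using edge_colors_monochromatic[OF p(1), of c x] p(3) by (simp add: F_def E_def)
    have qc: "edge_colors c q = replicate_mset b y"
      using edge_colors_monochromatic[OF q(1), of c y] q(3) by (simp add: F_def E_def)
    define T where "T = set p \<union> set q"
    have T: "finite T" "card T \<le> 2 * k + 2" "last p \<in> T" "hd q \<in> T"
    proof -
      have "card T \<le> length p + length q"
        unfolding T_def by (meson add_mono card_Un_le card_length order_trans)
      then show "card T \<le> 2 * k + 2" using p(3) q(3) ab by linarith
    qed (use ne in \<open>auto simp: T_def\<close>)
    define U where "U = {r \<in> Q - T. c {last p, r} = z \<and> c {hd q, r} = z}"
    have lh: "last p \<in> V - A - B" "hd q \<in> V - A - B" using last_in_set[OF ne(1)] hd_in_set[OF ne(2)] p(2) q(2) by (auto simp: W_def)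
    have "card Q \<le> 5 * card U + 5 * card T"
      unfolding U_def by (rule clique_neighbor[where V = V, OF col]) (use finABQ V T lh few in auto)
    then have "card A + card B + (k - 2) < card U" using T(2) cQ k cA cB by linarith
    moreover have "clique_system c x y z A B U" using clique_system_subset[OF sys] by (auto simp: U_def)
    ultimately obtain r where r: "r \<noteq> []" "distinct r" "set r \<subseteq> A \<union> B \<union> U" "hd r \<in> U" "last r \<in> U"
      "edge_colors c r = replicate_mset (2 * card A) x + replicate_mset (2 * card B) y + replicate_mset (k - 2) z"
      by (metis clique_system_path)
    have "distinct (p @ r @ q)"
      using p q r pq by (auto simp: path_in_def W_def U_def T_def)
    moreover have "set (p @ r @ q) \<subseteq> V" using p q r V by (auto simp: W_def U_def)
    moreover have "edge_colors c (p @ r @ q) = replicate_mset k x + replicate_mset k y + replicate_mset k z"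
    proof -
      have "c {last p, hd r} = z" "c {last r, hd q} = z" using r(4,5) by (auto simp: U_def insert_commute)
      then have "edge_colors c (p @ r @ q) = (replicate_mset a x + replicate_mset (2 * card A) x)
          + (replicate_mset b y + replicate_mset (2 * card B) y) + (replicate_mset (k - 2) z + {#z, z#})"
        using ne r by (simp add: edge_colors_append pc qc)
      also have "replicate_mset a x + replicate_mset (2 * card A) x = replicate_mset k x"
        using ab by (simp add: multiset_eq_iff a_def)
      also have "replicate_mset b y + replicate_mset (2 * card B) y = replicate_mset k y"
        using ab by (simp add: multiset_eq_iff b_def)
      also have "replicate_mset (k - 2) z + {#z, z#} = replicate_mset k z"
        using k False by (auto simp: multiset_eq_iff)
      finally show ?thesis .
    qed
    ultimately show ?thesis using ne xyz by (intro has_balanced_pathI[of "p @ r @ q"]) auto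
  qed
qed

section \<open>Saturating the clique and applying Ramsey's theorem\<close>

lemma clique_system_insert:
  assumes "clique_system c x y z A B Q" "v \<notin> A" "v \<notin> B" "v \<notin> Q"
  shows "clique_system c x y z (insert v A) B {q \<in> Q. c {v, q} = x}"
proof -
  define R where "R = {q \<in> Q. c {v, q} = x}"
  have "clique_system c x y z A B R"
    using assms(1) by (rule clique_system_subset) (auto simp: R_def)
  moreover have "v \<notin> R" "\<forall>q\<in>R. c {v, q} = x" using assms(4) by (auto simp: R_def)
  ultimately have "clique_system c x y z (insert v A) B R"
    using assms(2,3) unfolding clique_system_def by blast
  then show ?thesis by (simp only: R_def)
qed

text \<open>Vertices that see at least a fifth of the clique in colour \<open>x\<close> (or \<open>y\<close>) are moved to \<open>A\<close>
  (or \<open>B\<close>) while the clique shrinks to the part they see; at most \<open>2h\<close> such steps happen.\<close>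

lemma clique_system_saturate:
  assumes "clique_system c x y z A B Q" "A \<union> B \<union> Q \<subseteq> V" "x \<noteq> z" "y \<noteq> z"
    "card A \<le> h" "card B \<le> h" "2 * h = card A + card B + d" "card Q \<ge> 5 ^ d * M"
  shows "\<exists>A B Q. clique_system c x y z A B Q \<and> A \<union> B \<union> Q \<subseteq> V \<and> card A \<le> h \<and> card B \<le> h \<and> card Q \<ge> M \<and>
    (card A < h \<longrightarrow> (\<forall>v\<in>V - A - B. 5 * card {q \<in> Q - {v}. c {v, q} = x} \<le> card Q)) \<and>
    (card B < h \<longrightarrow> (\<forall>v\<in>V - A - B. 5 * card {q \<in> Q - {v}. c {v, q} = y} \<le> card Q))"
    (is "\<exists>A B Q. ?goal A B Q")
  using assms
proof (induction d arbitrary: A B Q)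
  \<comment> \<open>Here \<open>card A\<close> and \<open>card B\<close> both equal
    \<open>h\<close>, so the saturation conditions are vacuous.\<close>
  case 0
  then show ?case by (intro exI[of _ A] exI[of _ B] exI[of _ Q]) auto
next
  case (Suc d)
  note sys = Suc.prems(1)
  have fin: "finite A" "finite B" using sys by (auto simp: clique_system_def)
  \<comment> \<open>Inside \<open>Q\<close> all edges have colour \<open>z\<close>, so a vertex
    seeing much of \<open>Q\<close> in another colour lies outside \<open>Q\<close> and can be moved
    to \<open>A\<close> or \<open>B\<close>.\<close>
  have outside: "v \<notin> Q" "{q \<in> Q - {v}. c {v, q} = i} = {q \<in> Q. c {v, q} = i}"
    if "i \<noteq> z" "card Q < 5 * card {q \<in> Q - {v}. c {v, q} = i}" for v i
  proof -
    show "v \<notin> Q"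
    proof
      assume "v \<in> Q"
      then have "{q \<in> Q - {v}. c {v, q} = i} = {}" using sys that(1) by (auto simp: clique_system_def)
      then have "card {q \<in> Q - {v}. c {v, q} = i} = 0" by (simp only: card.empty)
      then show False using that(2) by linarith
    qed
    then show "{q \<in> Q - {v}. c {v, q} = i} = {q \<in> Q. c {v, q} = i}" by auto
  qed
  \<comment> \<open>An insertion lowers \<open>d\<close> by one and divides the size of
    \<open>Q\<close> by at most 5, which the factor \<open>5 ^ d\<close> pays for.\<close>
  consider (x) v where "card A < h" "v \<in> V - A - B" "card Q < 5 * card {q \<in> Q - {v}. c {v, q} = x}"
    | (y) v where "card B < h" "v \<in> V - A - B" "card Q < 5 * card {q \<in> Q - {v}. c {v, q} = y}"
    | (stop) "card A < h \<longrightarrow> (\<forall>v\<in>V - A - B. 5 * card {q \<in> Q - {v}. c {v, q} = x} \<le> card Q)"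
       "card B < h \<longrightarrow> (\<forall>v\<in>V - A - B. 5 * card {q \<in> Q - {v}. c {v, q} = y} \<le> card Q)"
    by (meson not_le)
  then show ?case
  proof cases
    case x
    note out = outside[OF Suc.prems(3) x(3)]
    show ?thesis
    proof (rule Suc.IH[of "insert v A" B "{q \<in> Q. c {v, q} = x}"])
      show "clique_system c x y z (insert v A) B {q \<in> Q. c {v, q} = x}"
        using clique_system_insert[OF sys] x(2) out(1) by auto
    qed (use Suc.prems x fin out in auto)
  next
    case y
    note out = outside[OF Suc.prems(4) y(3)]
    show ?thesis
    proof (rule Suc.IH[of A "insert v B" "{q \<in> Q. c {v, q} = y}"])
      show "clique_system c x y z A (insert v B) {q \<in> Q. c {v, q} = y}"
        using clique_system_insert[of c y x z B A Q v] sys y(2) out(1)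
        by (auto simp: clique_system_swap[of c x y])
    qed (use Suc.prems y fin out in auto)
  next
    case stop
    have "M \<le> 5 ^ Suc d * M" by simp
    then have "M \<le> card Q" using Suc.prems(8) by linarith
    then have "?goal A B Q" using Suc.prems(1,2,5,6) stop by blast
    then show ?thesis by blast
  qed
qed

text \<open>Saturation starts from empty \<open>A\<close> and \<open>B\<close> with
  \<open>2 * h\<close> steps available; \<open>2 * h\<close> is at most \<open>k + 1\<close>, whence
  the factor \<open>5 ^ (k + 1)\<close>. The three path lemmas cover all outcomes once
  \<open>x\<close> and \<open>y\<close> may be interchanged.\<close>

lemma balanced_path_if_clique:
  assumes fin: "finite V" and col: "\<And>e. e \<in> [V]\<^bsup>2\<^esup> \<Longrightarrow> c e \<in> {x, y, z}"
    and xyz: "x \<noteq> y" "x \<noteq> z" "y \<noteq> z" and k: "k \<ge> 1"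
    and Q: "R \<subseteq> V" "card R \<ge> 5 ^ (k + 1) * (50 * k)" "\<And>e. e \<in> [R]\<^bsup>2\<^esup> \<Longrightarrow> c e = z"
    and many: "\<And>i. i \<in> {x, y} \<Longrightarrow> card {e \<in> [V]\<^bsup>2\<^esup>. c e = i} > k * card V"
    and large: "card V \<ge> (k + 1)\<^sup>2 + 2 ^ (k + 1) * (2 * k + 3) * (k + 1)"
  shows "has_balanced_path c V {x, y, z} k"
proof -
  define h where "h = (k + 1) div 2"
  have "5 ^ (2 * h) * (50 * k) \<le> 5 ^ (k + 1) * (50 * k)"
    by (intro mult_right_mono power_increasing) (auto simp: h_def)
  then have "card R \<ge> 5 ^ (2 * h) * (50 * k)" using Q(2) by linarith
  moreover have "clique_system c x y z {} {} R"
    using Q fin by (auto simp: clique_system_def intro: finite_subset)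
  ultimately obtain A B Q where sys: "clique_system c x y z A B Q" and V: "A \<union> B \<union> Q \<subseteq> V"
    and AB: "card A \<le> h" "card B \<le> h" and cQ: "card Q \<ge> 50 * k"
    and fewx: "\<And>v. card A < h \<Longrightarrow> v \<in> V - A - B \<Longrightarrow> 5 * card {q \<in> Q - {v}. c {v, q} = x} \<le> card Q"
    and fewy: "\<And>v. card B < h \<Longrightarrow> v \<in> V - A - B \<Longrightarrow> 5 * card {q \<in> Q - {v}. c {v, q} = y} \<le> card Q"
    using clique_system_saturate[of c x y z "{}" "{}" R V h "2 * h" "50 * k"] Q(1) xyz by auto
  note sys' = sys[unfolded clique_system_swap[of c x y]]
  have col': "c e \<in> {y, x, z}" if "e \<in> [V]\<^bsup>2\<^esup>" for e using col[OF that] by auto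
  have V': "B \<union> A \<union> Q \<subseteq> V" using V by auto
  have D: "V - B - A = V - A - B" by auto
  have sw: "{y, x, z} = {x, y, z}" by auto
  consider "card A = h" "card B = h" | "card A < h" "card B = h" | "card A = h" "card B < h"
    | "card A < h" "card B < h" "card B \<le> card A" | "card A < h" "card B < h" "card A \<le> card B"
    using AB by linarith
  then show ?thesis
  proof cases
    case 1
    then show ?thesis
      using balanced_path_both_large[OF sys V xyz] cQ k by (simp add: h_def)
  next
    case 2
    then show ?thesis
      using balanced_path_one_large[OF fin col sys V xyz _ _ cQ k fewx] many by (simp add: h_def)
  next
    case 3
    then have "has_balanced_path c V {y, x, z} k"
      using balanced_path_one_large[OF fin col' sys' V' xyz(1)[symmetric] xyz(3,2) _ _ cQ k] fewy many
      by (simp add: h_def D)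
    then show ?thesis by (simp add: sw)
  next
    case 4
    show ?thesis
      by (rule balanced_path_both_small[OF fin col sys V xyz _ 4(3) cQ k _ _ _ large])
        (use 4 fewx fewy many in \<open>auto simp: h_def\<close>)
  next
    case 5
    have "has_balanced_path c V {y, x, z} k"
      by (rule balanced_path_both_small[OF fin col' sys' V' xyz(1)[symmetric] xyz(3,2) _ 5(3) cQ k _ _ _ large])
        (use 5 fewx fewy many in \<open>auto simp: h_def D\<close>)
    then show ?thesis by (simp add: sw)
  qed
qed

lemma eventually_has_balanced_path:
  assumes k: "k \<ge> 1"
  shows "\<forall>\<^sub>F n in at_top. \<forall>c. c \<in> [{..<n}]\<^bsup>2\<^esup> \<rightarrow> {..<3} \<longrightarrow>
    (\<forall>i<3. card {e \<in> [{..<n}]\<^bsup>2\<^esup>. c e = i} > k * n) \<longrightarrow> has_balanced_path c {..<n} {..<3} k"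
proof -
  define T where "T = 5 ^ (k + 1) * (50 * k)"
  define L where "L = (k + 1)\<^sup>2 + 2 ^ (k + 1) * (2 * k + 3) * (k + 1)"
  obtain N :: nat where N: "partn_lst {..<N} [T, T, T] 2" using ramsey_full[of "[T, T, T]" 2] by blast
  show ?thesis
    unfolding eventually_at_top_linorder
  proof (intro exI[of _ "max N L"] allI impI)
    fix n :: nat and c :: "nat set \<Rightarrow> nat"
    assume n: "max N L \<le> n" and c: "c \<in> [{..<n}]\<^bsup>2\<^esup> \<rightarrow> {..<3}"
      and many: "\<forall>i<3. card {e \<in> [{..<n}]\<^bsup>2\<^esup>. c e = i} > k * n"
    have "partn_lst {..<n} [T, T, T] 2" using partn_lst_greater_resource[OF N] n by simp
    then obtain z Q where z: "z < 3" and Q: "Q \<in> [{..<n}]\<^bsup>([T, T, T] ! z)\<^esup>" "c ` [Q]\<^bsup>2\<^esup> \<subseteq> {z}"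
      using c by (elim partn_lstE[where l = 3]) (auto simp: numeral_3_eq_3)
    have three: "{..<3} = {0, 1, 2::nat}" by auto
    have "[T, T, T] ! z = T" using z by (auto simp: less_Suc_eq numeral_3_eq_3)
    then have Q': "Q \<subseteq> {..<n}" "card Q \<ge> 5 ^ (k + 1) * (50 * k)" "\<And>e. e \<in> [Q]\<^bsup>2\<^esup> \<Longrightarrow> c e = z"
      using Q by (auto simp: nsets_def T_def)
    \<comment> \<open>The clique may come in any colour \<open>z\<close>; the other two become
      \<open>x\<close> and \<open>y\<close>.\<close>
    obtain x y where xyz: "x \<noteq> y" "x \<noteq> z" "y \<noteq> z" "{x, y, z} = {..<3}"
    proof -
      have "z = 0 \<or> z = 1 \<or> z = 2" using z by auto
      then show ?thesis
        using that[of 1 2] that[of 0 2] that[of 0 1] by (auto simp: three insert_commute)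
    qed
    then have lt: "x < 3" "y < 3" by auto
    have "has_balanced_path c {..<n} {x, y, z} k"
      by (rule balanced_path_if_clique[OF _ _ xyz(1-3) k Q'])
        (use c many lt n xyz(4) in \<open>auto simp: L_def\<close>)
    then show "has_balanced_path c {..<n} {..<3} k" by (simp add: xyz(4))
  qed
qed

section \<open>From vertex lists to copies of path graphs\<close>

lemma complete_graph_edges: "edges (complete_graph n) = [{..<n}]\<^bsup>2\<^esup>"
  by (auto simp: complete_graph_def edges_def nsets_def intro: finite_subset)

lemma card_edges_path_graph: "card (edges (path_graph m)) = m"
proof -
  have "edges (path_graph m) = (\<lambda>i. {i, Suc i}) ` {..<m}" by (auto simp: path_graph_def edges_def)
  moreover have "inj_on (\<lambda>i. {i, Suc i}) {..<m}" by (auto simp: inj_on_def doubleton_eq_iff)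
  ultimately show ?thesis by (simp add: card_image)
qed

lemma isomorphic_edges:
  assumes "bij_betw f (verts G) (verts H)" "edges H = (\<lambda>e. f ` e) ` edges G" "\<And>e. e \<in> edges G \<Longrightarrow> e \<subseteq> verts G"
  shows "bij_betw (\<lambda>e. f ` e) (edges G) (edges H)"
proof -
  have "inj_on f (verts G)" using assms(1) by (rule bij_betw_imp_inj_on)
  then have "inj_on (\<lambda>e. f ` e) (edges G)"
    using assms(3) by (intro inj_onI) (simp add: inj_on_image_eq_iff)
  then show ?thesis by (simp add: bij_betw_def assms(2))
qed

lemma path_graph_edges_subset: "e \<in> edges (path_graph m) \<Longrightarrow> e \<subseteq> verts (path_graph m)"
  by (auto simp: path_graph_def edges_def verts_def)

text \<open>With \<open>3 * k\<close> edges, the floor and the ceiling in \<open>balanced3\<close>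
  both equal \<open>k\<close>.\<close>

lemma balanced3_path_copy:
  assumes "isomorphic (path_graph (3 * k)) H"
  shows "balanced3 H c \<longleftrightarrow> (\<forall>i<3. card (color_class H c i) = k)"
proof -
  obtain f where "bij_betw f (verts (path_graph (3 * k))) (verts H)"
    "edges H = (\<lambda>e. f ` e) ` edges (path_graph (3 * k))"
    using assms by (auto simp: isomorphic_def)
  then have "card (edges H) = 3 * k"
    using isomorphic_edges path_graph_edges_subset bij_betw_same_card card_edges_path_graph by metis
  then show ?thesis by (simp add: balanced3_def)
qed

text \<open>In index form, the multiplicity of a colour counts positions, which are in bijection
  with the edges of the copy.\<close>

lemma edge_colors_nth:
  "edge_colors c p = image_mset (\<lambda>i. c {p ! i, p ! Suc i}) (mset_set {..<length p - 1})"
proof (induction c p rule: edge_colors.induct)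
  case (1 c x y p)
  have "{..<length (x # y # p) - 1} = insert 0 (Suc ` {..<length (y # p) - 1})"
    by (auto simp: image_iff less_Suc_eq_0_disj)
  then have "mset_set {..<length (x # y # p) - 1} = add_mset 0 (image_mset Suc (mset_set {..<length (y # p) - 1}))"
    by (simp add: image_mset_mset_set)
  then show ?case using 1 by (simp add: multiset.map_comp comp_def)
qed auto

lemma contains_balanced_copy_if_path:
  assumes "has_balanced_path c {..<n} {..<3} k"
  shows "contains_balanced_copy (complete_graph n) c (path_graph (3 * k))"
proof -
  obtain p where p: "p \<noteq> []" "distinct p" "set p \<subseteq> {..<n}"
    and pc: "edge_colors c p = (\<Sum>i<3. replicate_mset k i)"
    using assms by (auto simp: has_balanced_path_def)
  \<comment> \<open>The length of the path is recovered from the number of its colours;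
    \<open>p\<close> being nonempty matters because \<open>length p - 1\<close> truncates.\<close>
  have "size (edge_colors c p) = 3 * k" by (simp add: pc numeral_3_eq_3)
  then have len: "length p = 3 * k + 1" using p(1) by (cases p) (simp_all add: size_edge_colors)
  define H where "H = (set p, (\<lambda>e. (!) p ` e) ` edges (path_graph (3 * k)))"
  have pe: "edges (path_graph (3 * k)) = (\<lambda>i. {i, Suc i}) ` {..<3 * k}" by (auto simp: path_graph_def edges_def)
  have bij: "bij_betw ((!) p) (verts (path_graph (3 * k))) (verts H)"
    using bij_betw_nth[OF p(2), of "{..3 * k}" "set p"] len
    by (simp add: H_def verts_def path_graph_def lessThan_Suc_atMost flip: Suc_eq_plus1)
  have iso: "isomorphic (path_graph (3 * k)) H"
    using bij unfolding isomorphic_def by (auto simp: H_def edges_def)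
  have eH: "edges H = (\<lambda>i. {p ! i, p ! Suc i}) ` {..<3 * k}"
  proof -
    have "edges H = (\<lambda>e. (!) p ` e) ` edges (path_graph (3 * k))" by (simp add: H_def edges_def)
    then show ?thesis by (simp add: pe image_image)
  qed
  have inj: "inj_on (\<lambda>i. {p ! i, p ! Suc i}) {..<3 * k}"
    using p(2) len by (auto simp: inj_on_def doubleton_eq_iff nth_eq_iff_index_eq)
  have "card (color_class H c i) = k" if "i < 3" for i
  proof -
    have "color_class H c i = (\<lambda>i. {p ! i, p ! Suc i}) ` {j \<in> {..<3 * k}. c {p ! j, p ! Suc j} = i}"
      by (auto simp: color_class_def eH)
    then have "card (color_class H c i) = card {j \<in> {..<3 * k}. c {p ! j, p ! Suc j} = i}"
      using card_image[OF inj_on_subset[OF inj]] by (metis (no_types, lifting) mem_Collect_eq subsetI)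
    also have "\<dots> = count (edge_colors c p) i"
      unfolding edge_colors_nth len
      by (simp add: count_image_mset' eq_commute conj_commute)
    also have "\<dots> = k" using that unfolding pc by (auto simp: count_sum numeral_3_eq_3 less_Suc_eq)
    finally show ?thesis .
  qed
  then have "balanced3 H c" by (simp add: balanced3_path_copy[OF iso])
  moreover have "subgraph H (complete_graph n)"
    unfolding subgraph_def complete_graph_edges
  proof
    show "verts H \<subseteq> verts (complete_graph n)" using p by (simp add: H_def verts_def complete_graph_def)
    show "edges H \<subseteq> [{..<n}]\<^bsup>2\<^esup>"
    proof
      fix e assume "e \<in> edges H"
      then obtain j where j: "j < 3 * k" "e = {p ! j, p ! Suc j}" by (auto simp: eH)
      then have "p ! j \<in> set p" "p ! Suc j \<in> set p" "p ! j \<noteq> p ! Suc j"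
        using p(2) len by (auto simp: nth_eq_iff_index_eq)
      then show "e \<in> [{..<n}]\<^bsup>2\<^esup>" using p(3) j(2) by auto
    qed
  qed
  ultimately show ?thesis using iso unfolding contains_balanced_copy_def by blast
qed

lemma eventually_bal3_bound:
  assumes "k \<ge> 1"
  shows "\<forall>\<^sub>F n in at_top. bal3_bound n (path_graph (3 * k)) (k * n)"
  using eventually_has_balanced_path[OF assms]
proof eventually_elim
  case (elim n)
  then show ?case
    by (auto simp: bal3_bound_def coloring3_def color_class_def complete_graph_edges
        intro!: contains_balanced_copy_if_path)
qed

section \<open>The lower bound\<close>

lemma path_copy_degree_le_2:
  assumes "isomorphic (path_graph m) H"
  shows "card {e \<in> edges H. v \<in> e} \<le> 2"
proof -
  obtain f where f: "bij_betw f {..m} (verts H)" and eH: "edges H = (\<lambda>e. f ` e) ` edges (path_graph m)"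
    using assms by (auto simp: isomorphic_def path_graph_def verts_def)
  define I where "I = {i. i < m \<and> v \<in> {f i, f (Suc i)}}"
  have "{e \<in> edges H. v \<in> e} \<subseteq> (\<lambda>i. {f i, f (Suc i)}) ` I"
    unfolding eH by (auto simp: path_graph_def edges_def I_def)
  then have "card {e \<in> edges H. v \<in> e} \<le> card I" by (rule surj_card_le[rotated]) (simp add: I_def)
  also have "card I \<le> 2"
  proof (cases "\<exists>j\<le>m. f j = v")
    case True
    then obtain j where j: "j \<le> m" "f j = v" by blast
    have "i = j \<or> i = j - 1" if "i \<in> I" for i
    proof -
      have "f i = f j \<or> f (Suc i) = f j" "i < m" using that j by (auto simp: I_def)
      then have "i = j \<or> Suc i = j"
        using bij_betw_imp_inj_on[OF f] j(1) by (auto dest!: inj_onD)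
      then show ?thesis by auto
    qed
    then have "I \<subseteq> {j, j - 1}" by blast
    then have "card I \<le> card {j, j - 1}" by (intro card_mono) auto
    also have "\<dots> \<le> 2" by (simp add: card_insert_if)
    finally show ?thesis .
  next
    case False
    then have "I = {}" by (auto simp: I_def) (metis Suc_leI order_less_imp_le)+
    then show ?thesis by simp
  qed
  finally show ?thesis .
qed

lemma card_parity_class:
  assumes "b < 2" "k \<ge> 1"
  shows "n - k \<le> 2 * card {j \<in> {k - 1..<n}. j mod 2 = b}"
proof -
  \<comment> \<open>The shift \<open>s\<close> is 0 or 1 and gives \<open>q + s\<close> the parity
    \<open>b\<close>; the progression of step 2 from there has \<open>(n - q) div 2\<close> terms
    below \<open>n\<close>.\<close>
  define q s where "q = k - 1" and "s = (q + b) mod 2"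
  define g where "g t = q + s + 2 * t" for t
  have s: "s < 2" by (simp add: s_def)
  have "(q + s) mod 2 = (2 * q + b) mod 2" unfolding s_def mod_add_right_eq by (simp only: mult_2 add.assoc)
  then have "(q + s) mod 2 = b" using assms(1) by simp
  then have "g t mod 2 = b" for t by (simp add: g_def)
  moreover have "g t < n" if "t < (n - q) div 2" for t
    using that s unfolding g_def by linarith
  ultimately have "g ` {..<(n - q) div 2} \<subseteq> {j \<in> {q..<n}. j mod 2 = b}" by (auto simp: g_def)
  then have "card (g ` {..<(n - q) div 2}) \<le> card {j \<in> {q..<n}. j mod 2 = b}"
    by (intro card_mono) auto
  moreover have "card (g ` {..<(n - q) div 2}) = (n - q) div 2"
    by (subst card_image) (auto simp: inj_on_def g_def)
  moreover have "n - k \<le> 2 * ((n - q) div 2)" using assms(2) by (simp add: q_def)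
  ultimately show ?thesis unfolding q_def by linarith
qed

lemma bal3_bound_lower:
  assumes k: "k \<ge> 1" and n: "n \<ge> 2 * k" and bound: "bal3_bound n (path_graph (3 * k)) m"
  shows "(k - 1) * (n - k) \<le> 2 * m"
proof (rule ccontr)
  assume "\<not> ?thesis"
  then have m: "2 * m < (k - 1) * (n - k)" by simp
  \<comment> \<open>For an edge between the special set \<open>{..<k - 1}\<close> and the rest,
    \<open>Max e\<close> is the outside endpoint, so its parity splits the edges at each special
    vertex almost evenly between colours 1 and 2.\<close>
  define c :: "nat set \<Rightarrow> nat" where
    "c e = (if e \<inter> {..<k - 1} = {} then 0 else 1 + Max e mod 2)" for e
  have "coloring3 (complete_graph n) c"
    by (auto simp: coloring3_def c_def)
  moreover have "card (color_class (complete_graph n) c i) > m" if "i < 3" for i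
  proof (cases "i = 0")
    case True
    have "[{k - 1..<n}]\<^bsup>2\<^esup> \<subseteq> color_class (complete_graph n) c i"
      unfolding color_class_def complete_graph_edges by (auto simp: True c_def nsets_def)
    then have "card ([{k - 1..<n}]\<^bsup>2\<^esup>) \<le> card (color_class (complete_graph n) c i)"
      by (rule card_mono[rotated]) (simp add: color_class_def complete_graph_edges finite_imp_finite_nsets)
    moreover have "2 * card ([{k - 1..<n}]\<^bsup>2\<^esup>) = (n - (k - 1)) * (n - (k - 1) - 1)"
    proof -
      have "even ((n - (k - 1)) * (n - (k - 1) - 1))" by (cases "n - (k - 1)") auto
      then show ?thesis by (simp add: card_nsets choose_two dvd_mult_div_cancel)
    qed
    \<comment> \<open>The assumption \<open>n \<ge> 2 * k\<close> makes the clique on the other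
      vertices large enough for colour 0.\<close>
    moreover have "(k - 1) * (n - k) \<le> (n - (k - 1)) * (n - (k - 1) - 1)"
      using n k by (intro mult_mono) auto
    ultimately show ?thesis using m by linarith
  next
    case False
    define b where "b = i - 1"
    have b: "b < 2" "i = 1 + b" using that False by (auto simp: b_def)
    define J where "J = {j \<in> {k - 1..<n}. j mod 2 = b}"
    have "(\<lambda>(a, j). {a, j}) ` ({..<k - 1} \<times> J) \<subseteq> color_class (complete_graph n) c i"
    proof
      fix e assume "e \<in> (\<lambda>(a, j). {a, j}) ` ({..<k - 1} \<times> J)"
      then obtain a j where e: "e = {a, j}" "a < k - 1" "k - 1 \<le> j" "j < n" "j mod 2 = b"
        by (auto simp: J_def)
      then have "Max e = j" by simp
      then show "e \<in> color_class (complete_graph n) c i"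
        using e b by (auto simp: color_class_def complete_graph_edges c_def)
    qed
    then have "card ((\<lambda>(a, j). {a, j}) ` ({..<k - 1} \<times> J)) \<le> card (color_class (complete_graph n) c i)"
      by (rule card_mono[rotated]) (simp add: color_class_def complete_graph_edges finite_imp_finite_nsets)
    moreover have "inj_on (\<lambda>(a, j). {a, j}) ({..<k - 1} \<times> J)"
      by (auto simp: inj_on_def doubleton_eq_iff J_def)
    ultimately have "(k - 1) * card J \<le> card (color_class (complete_graph n) c i)"
      by (simp add: card_image card_cartesian_product)
    moreover have "(k - 1) * (n - k) \<le> 2 * ((k - 1) * card J)"
      using mult_le_mono2[OF card_parity_class[OF b(1) k, of n], of "k - 1"] by (simp add: J_def)
    ultimately show ?thesis using m by linarith
  qed
  ultimately have "contains_balanced_copy (complete_graph n) c (path_graph (3 * k))"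
    using bound unfolding bal3_bound_def by blast
  then obtain H where sub: "subgraph H (complete_graph n)" and iso: "isomorphic (path_graph (3 * k)) H"
    and bal: "balanced3 H c" unfolding contains_balanced_copy_def by blast
  have col: "card (color_class H c i) = k" if "i < 3" for i
    using bal that by (simp add: balanced3_path_copy[OF iso])
  have fin: "finite (edges H)"
    using sub finite_subset finite_imp_finite_nsets unfolding subgraph_def complete_graph_edges by blast
  \<comment> \<open>Double counting: \<open>2 * k\<close> edges of colours 1 and 2 would all meet
    \<open>k - 1\<close> vertices of degree at most 2.\<close>
  have "2 * k = card (color_class H c 1) + card (color_class H c 2)" using col by simp
  also have "\<dots> = card (color_class H c 1 \<union> color_class H c 2)"
    using fin by (intro card_Un_disjoint[symmetric]) (auto simp: color_class_def)
  also have "\<dots> \<le> card (\<Union>v<k - 1. {e \<in> edges H. v \<in> e})"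
    using fin by (intro card_mono) (auto simp: color_class_def c_def split: if_splits)
  also have "\<dots> \<le> (\<Sum>v<k - 1. card {e \<in> edges H. v \<in> e})" by (rule card_UN_le) simp
  also have "\<dots> \<le> (\<Sum>v<k - 1. 2)" by (intro sum_mono path_copy_degree_le_2[OF iso])
  finally show False using k by simp
qed

section \<open>The asymptotic statement\<close>

theorem theorem1p10:
  fixes k :: nat
  assumes "k \<ge> 1"
  shows "\<exists>\<epsilon> \<in> o(\<lambda>_. 1). \<exists>\<delta> \<in> o(\<lambda>_. 1). \<forall>\<^sub>F n :: nat in at_top.
    ereal (((real k - 1) / 2 + \<epsilon> n) * real n) \<le> ereal_of_enat (bal3 n (path_graph (3 * k))) \<and>
    ereal_of_enat (bal3 n (path_graph (3 * k))) \<le> ereal ((real k + \<delta> n) * real n)"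
proof -
  \<comment> \<open>Times \<open>n\<close>, this error is the constant \<open>- k^2\<close>, which
    absorbs the deficit \<open>k (k - 1) / 2\<close> of \<open>(k - 1) (n - k) / 2\<close>. The
    upper bound \<open>k * n\<close> holds for all large \<open>n\<close>, so its error is
    0.\<close>
  define \<epsilon> where "\<epsilon> n = - (real k)\<^sup>2 / real n" for n
  have "\<epsilon> \<in> o(\<lambda>_. 1)"
    using lim_const_over_n[of "- (real k)\<^sup>2"] by (intro smalloI_tendsto) (auto simp: \<epsilon>_def)
  moreover have "(\<lambda>_. 0) \<in> o(\<lambda>_. 1 :: real)" by simp
  moreover have "\<forall>\<^sub>F n :: nat in at_top.
    ereal (((real k - 1) / 2 + \<epsilon> n) * real n) \<le> ereal_of_enat (bal3 n (path_graph (3 * k))) \<and>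
    ereal_of_enat (bal3 n (path_graph (3 * k))) \<le> ereal ((real k + 0) * real n)"
    using eventually_bal3_bound[OF assms] eventually_ge_at_top[of "2 * k"]
  proof eventually_elim
    case (elim n)
    define L where "L = (LEAST m. bal3_bound n (path_graph (3 * k)) m)"
    have bal: "bal3 n (path_graph (3 * k)) = enat L" using elim(1) by (auto simp: bal3_def L_def)
    have "bal3_bound n (path_graph (3 * k)) L" unfolding L_def using elim(1) by (rule LeastI)
    from bal3_bound_lower[OF assms elim(2) this] have "real ((k - 1) * (n - k)) \<le> real (2 * L)"
      by (rule of_nat_mono)
    moreover have "real ((k - 1) * (n - k)) = (real k - 1) * (real n - real k)"
      using assms elim(2) by (simp add: of_nat_diff)
    ultimately have "(real k - 1) * (real n - real k) \<le> 2 * real L" by simp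
    moreover have "(real k - 1) * real k \<le> 2 * (real k)\<^sup>2"
      by (simp add: power2_eq_square algebra_simps)
    ultimately have "(real k - 1) / 2 * real n - (real k)\<^sup>2 \<le> real L"
      by (simp add: algebra_simps)
    moreover have "((real k - 1) / 2 + \<epsilon> n) * real n = (real k - 1) / 2 * real n - (real k)\<^sup>2"
      using assms elim(2) by (simp add: \<epsilon>_def field_simps)
    moreover have "L \<le> k * n" unfolding L_def using elim(1) by (rule Least_le)
    then have "real L \<le> real k * real n" by (metis of_nat_mono of_nat_mult)
    ultimately show ?case by (simp add: bal)
  qed
  ultimately show ?thesis by (intro bexI[of _ \<epsilon>] bexI[of _ "\<lambda>_. 0"])
qed

end
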